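(* Let $K$ be a field of characteristic zero and let $A=\mathrm{diag}(J_{n_1,\lambda_1},\dots,J_{n_k,\lambda_k})\in \mathrm{GL}_n(K)$ (all $\lambda_i\neq 0$, $n=n_1+\dots+n_k$) be an invertible block diagonal matrix of multiplicative Jordan blocks with $n_1\ge\dots\ge n_l\ge 2>n_{l+1}=\dots=n_k=1$ and $l>0$. Let $p_1,\dots,p_{n-1}$ be the $n-1$ semi-invariant forms of $A$, with multipliers $\mu_1,\dots,\mu_{n-1}$, defined in the context. Then $p_1,\dots,p_{n-1}$ generate all semi-invariant forms of $A$ in the following sense. Any semi-invariant polynomial for $A$ with multiplier $\lambda$ can be uniquely expressed as a rational function $$\frac{\sum_I c_I\,p_I}{\prod_{i=1}^{l}a_{0,i}^{m_i}},$$ where the $m_i\ge 0$ are integers, $I$ runs over all multi-subsets of $\{1,\dots,n-1\}$ such that $\prod_{i\in I}\mu_i=\lambda\prod_{i=1}^l\lambda_i^{m_i}$, $p_I=\prod_{i\in I}p_i$, and $c_I\in K$ is non-zero only for finitely many $I$.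
   Context: $J_{m,\lambda}$ denotes the $m\times m$ (multiplicative) Jordan block with $\lambda$ on the main diagonal, $\lambda$ on the diagonal immediately below it, and $0$ elsewhere. A polynomial $p$ in $n$ variables over $K$ is a semi-invariant of $A$ with multiplier $\lambda\in K$ if $p(Aa)=\lambda p(a)$, where $a$ is the column vector of variables. Here the variables, in order, are $a_{0,1},\dots,a_{n_1-1,1},a_{0,2},\dots,a_{n_2-1,2},\dots,a_{0,k},\dots,a_{n_k-1,k}$. A form is a homogeneous polynomial. In a multi-subset, repetition of elements is allowed. Auxiliary polynomials in variables $a_0,a_1,\dots$ (with $\binom{r}{s}=0$ if $s<0$ or $r<s$, and $\binom00=1$): For even $r=2m\ge 2$, $$P_r=\sum_{i=0}^m\sum_{j=m}^{2m-i}(-1)^i\left[\binom{m-i}{j-m}+\binom{m-i-1}{j-m-1}\right]a_ia_j .$$ For odd $r\ge 3$, with $m=\frac{r+1}{2}$, $$P_r=a_1P_{r-1}+a_0\sum_{i=0}^{m-1}\sum_{j=m}^{2m-1-i}(-1)^{i-1}(j-i)\binom{m-i-1}{j-m}a_ia_j .$$ Thus $P_r\in K[a_0,\dots,a_r]$ is quadratic for even $r$ and cubic for odd $r$. The list $p_1,\dots,p_{n-1}$ consists (in any order) of: (i) the $k$ linear forms $a_{0,1},\dots,a_{0,k}$, with multipliers $\lambda_1,\dots,\lambda_k$; (ii) for each $i$ with $n_i\ge 3$, the $n_i-2$ forms $P_r(a_{0,i},a_{1,i},\dots,a_{r,i})$ for $r=2,\dots,n_i-1$, with multiplier $\lambda_i^2$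 if $r$ is even and $\lambda_i^3$ if $r$ is odd; (iii) for each $i=1,\dots,l-1$, the quadratic form $a_{0,i}a_{1,i+1}-a_{1,i}a_{0,i+1}$, with multiplier $\lambda_i\lambda_{i+1}$. *)

theory Defs
  imports Complex_Main "HOL-Library.Poly_Mapping" "HOL-Library.Multiset"
    "Jordan_Normal_Form.Matrix"
begin

section \<open>Multivariate polynomials\<close>

text \<open>
  Polynomials in variables \<open>x\<^sub>0, x\<^sub>1, \<dots>\<close> are finitely supported functions from monomials (exponent
  vectors) to coefficients.  Being a polynomial in the first \<open>n\<close> variables is the predicate
  \<open>poly_in n\<close>.
\<close>

type_synonym 'a mpoly = "(nat \<Rightarrow>\<^sub>0 nat) \<Rightarrow>\<^sub>0 'a"

definition mconst :: "'a::zero \<Rightarrow> 'a mpoly" where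
  "mconst c = Poly_Mapping.single 0 c"

definition mvar :: "nat \<Rightarrow> 'a::zero_neq_one mpoly" where
  "mvar v = Poly_Mapping.single (Poly_Mapping.single v 1) 1"

definition poly_in :: "nat \<Rightarrow> 'a::zero mpoly \<Rightarrow> bool" where
  "poly_in n p \<longleftrightarrow> (\<forall>t \<in> Poly_Mapping.keys p. Poly_Mapping.keys t \<subseteq> {..<n})"

definition homogeneous :: "'a::zero mpoly \<Rightarrow> bool" where
  "homogeneous p \<longleftrightarrow>
     (\<exists>d. \<forall>t \<in> Poly_Mapping.keys p. (\<Sum>v \<in> Poly_Mapping.keys t. Poly_Mapping.lookup t v) = d)"

definition msubst :: "(nat \<Rightarrow> 'a mpoly) \<Rightarrow> 'a::comm_ring_1 mpoly \<Rightarrow> 'a mpoly" where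
  "msubst f p =
     (\<Sum>t \<in> Poly_Mapping.keys p. mconst (Poly_Mapping.lookup p t) *
        (\<Prod>v \<in> Poly_Mapping.keys t. f v ^ Poly_Mapping.lookup t v))"

section \<open>Semi-invariants of a matrix\<close>

text \<open>The \<open>i\<close>-th entry of \<open>A a\<close>, where \<open>a\<close> is the column vector of variables.\<close>

definition mat_act :: "'a::comm_ring_1 mat \<Rightarrow> nat \<Rightarrow> 'a mpoly" where
  "mat_act A i = (\<Sum>j<dim_col A. mconst (A $$ (i, j)) * mvar j)"

definition semi_invariant :: "'a::comm_ring_1 mat \<Rightarrow> 'a \<Rightarrow> 'a mpoly \<Rightarrow> bool" where
  "semi_invariant A \<kappa> p \<longleftrightarrow> poly_in (dim_row A) p \<and> msubst (mat_act A) p = mconst \<kappa> * p"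

text \<open>The multiplicative Jordan block: \<open>\<kappa>\<close> also on the subdiagonal (unlike \<open>jordan_block\<close>, which
  has \<open>1\<close> on the superdiagonal).\<close>

definition mult_jordan_block :: "nat \<Rightarrow> 'a::zero \<Rightarrow> 'a mat" where
  "mult_jordan_block m \<kappa> = mat m m (\<lambda>(i, j). if i = j \<or> i = Suc j then \<kappa> else 0)"

text \<open>Blocks are numbered \<open>1, \<dots>, k\<close>; block \<open>i\<close> has size \<open>ns i\<close> and eigenvalue \<open>lam i\<close>.\<close>

definition jordan_diag :: "nat \<Rightarrow> (nat \<Rightarrow> nat) \<Rightarrow> (nat \<Rightarrow> 'a::zero) \<Rightarrow> 'a mat" where
  "jordan_diag k ns lam = diag_block_mat (map (\<lambda>i. mult_jordan_block (ns i) (lam i)) [1..<Suc k])"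

text \<open>\<open>avar ns s i\<close> is \<open>a\<^bsub>s,i\<^esub>\<close>, for \<open>s < ns i\<close>: the variable with position \<open>s\<close> in block \<open>i\<close>.\<close>

definition avar :: "(nat \<Rightarrow> nat) \<Rightarrow> nat \<Rightarrow> nat \<Rightarrow> 'a::zero_neq_one mpoly" where
  "avar ns s i = mvar ((\<Sum>t \<in> {1..<i}. ns t) + s)"

section \<open>The polynomials \<open>P\<^sub>r\<close>\<close>

text \<open>Binomial coefficient on integers, vanishing unless \<open>0 \<le> s \<le> r\<close>; the arguments below can be
  negative, so natural number subtraction would give wrong values.\<close>

definition zbinom :: "int \<Rightarrow> int \<Rightarrow> int" where
  "zbinom r s = (if 0 \<le> s \<and> s \<le> r then int (nat r choose nat s) else 0)"

definition P_even :: "(nat \<Rightarrow> 'b::comm_ring_1) \<Rightarrow> nat \<Rightarrow> 'b" where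
  "P_even a m =
     (\<Sum>i = 0..m. \<Sum>j = m..2 * m - i.
        of_int ((- 1) ^ i *
          (zbinom (int m - int i) (int j - int m) +
           zbinom (int m - int i - 1) (int j - int m - 1))) * a i * a j)"

text \<open>The sign \<open>(- 1) ^ (i - 1)\<close> is written \<open>(- 1) ^ (i + 1)\<close>, as \<open>i\<close> may be \<open>0\<close>.\<close>

definition P_odd :: "(nat \<Rightarrow> 'b::comm_ring_1) \<Rightarrow> nat \<Rightarrow> 'b" where
  "P_odd a m =
     a 1 * P_even a (m - 1) +
     a 0 * (\<Sum>i = 0..m - 1. \<Sum>j = m..2 * m - 1 - i.
        of_int ((- 1) ^ (i + 1) * (int j - int i) * zbinom (int m - int i - 1) (int j - int m))
          * a i * a j)"

text \<open>Meaningful for \<open>r \<ge> 2\<close> only.\<close>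

definition P_form :: "(nat \<Rightarrow> 'b::comm_ring_1) \<Rightarrow> nat \<Rightarrow> 'b" where
  "P_form a r = (if even r then P_even a (r div 2) else P_odd a ((r + 1) div 2))"

section \<open>The generators\<close>

text \<open>
  Labels indexing the \<open>n - 1\<close> forms: \<open>Lin i\<close> for \<open>a\<^bsub>0,i\<^esub>\<close>, \<open>Blk i r\<close> for \<open>P\<^sub>r\<close> in the variables of
  block \<open>i\<close>, and \<open>Mix i\<close> for the quadratic form linking blocks \<open>i\<close> and \<open>i + 1\<close>.
\<close>

datatype gen = Lin nat | Blk nat nat | Mix nat

definition gens :: "nat \<Rightarrow> nat \<Rightarrow> (nat \<Rightarrow> nat) \<Rightarrow> gen set" where
  "gens k l ns =
     Lin ` {1..k} \<union>
     {Blk i r | i r. i \<in> {1..k} \<and> 3 \<le> ns i \<and> 2 \<le> r \<and> r \<le> ns i - 1} \<union>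
     Mix ` {1..<l}"

fun gen_form :: "(nat \<Rightarrow> nat) \<Rightarrow> gen \<Rightarrow> 'a::comm_ring_1 mpoly" where
  "gen_form ns (Lin i) = avar ns 0 i"
| "gen_form ns (Blk i r) = P_form (\<lambda>s. avar ns s i) r"
| "gen_form ns (Mix i) = avar ns 0 i * avar ns 1 (i + 1) - avar ns 1 i * avar ns 0 (i + 1)"

fun gen_mult :: "(nat \<Rightarrow> 'a::comm_ring_1) \<Rightarrow> gen \<Rightarrow> 'a" where
  "gen_mult lam (Lin i) = lam i"
| "gen_mult lam (Blk i r) = (if even r then lam i ^ 2 else lam i ^ 3)"
| "gen_mult lam (Mix i) = lam i * lam (i + 1)"

section \<open>Expressions in the generators\<close>

text \<open>
  A finitely supported family of coefficients \<open>c\<^sub>I\<close>, indexed by multi-subsets \<open>I\<close> of the generators,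
  is an element of \<open>gen multiset \<Rightarrow>\<^sub>0 'a\<close>.  With the convolution product this type is the polynomial
  ring over \<open>'a\<close> with one formal indeterminate per label.

  \<open>expresses k l ns lam \<kappa> m c p\<close> states that
  \<open>p = (\<Sum>\<^sub>I c\<^sub>I p\<^sub>I) / (\<Prod>\<^sub>i\<^sub>\<le>\<^sub>l a\<^bsub>0,i\<^esub> ^ m\<^sub>i)\<close> (with the denominator cleared), where only
  multi-subsets whose multiplier is \<open>\<kappa> * (\<Prod>\<^sub>i\<^sub>\<le>\<^sub>l lam\<^sub>i ^ m\<^sub>i)\<close> occur.
\<close>

definition expresses ::
  "nat \<Rightarrow> nat \<Rightarrow> (nat \<Rightarrow> nat) \<Rightarrow> (nat \<Rightarrow> 'a::field) \<Rightarrow> 'a \<Rightarrow> (nat \<Rightarrow> nat) \<Rightarrow>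
     (gen multiset \<Rightarrow>\<^sub>0 'a) \<Rightarrow> 'a mpoly \<Rightarrow> bool" where
  "expresses k l ns lam \<kappa> m c p \<longleftrightarrow>
     (\<forall>I \<in> Poly_Mapping.keys c. set_mset I \<subseteq> gens k l ns \<and>
        (\<Prod>x\<in>#I. gen_mult lam x) = \<kappa> * (\<Prod>i = 1..l. lam i ^ m i)) \<and>
     p * (\<Prod>i = 1..l. avar ns 0 i ^ m i) =
       (\<Sum>I \<in> Poly_Mapping.keys c.
          mconst (Poly_Mapping.lookup c I) * (\<Prod>x\<in>#I. gen_form ns x))"

text \<open>
  Since the \<open>a\<^bsub>0,i\<^esub>\<close> are themselves generators, numerator and denominator of an expression can
  always be multiplied by a common power of \<open>a\<^bsub>0,i\<^esub>\<close>.  Uniqueness is therefore equality of formal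
  fractions: \<open>denom l m\<close> is the denominator, viewed as a monomial in the formal indeterminates.
\<close>

definition denom :: "nat \<Rightarrow> (nat \<Rightarrow> nat) \<Rightarrow> (gen multiset \<Rightarrow>\<^sub>0 'a::comm_ring_1)" where
  "denom l m = Poly_Mapping.single (\<Sum>i = 1..l. replicate_mset (m i) (Lin i)) 1"

text \<open>In particular, for a fixed denominator the coefficients are determined:\<close>

lemma denom_cancel:
  assumes "c * denom l m = c' * denom l m"
  shows "c = c'"
proof (rule poly_mapping_eqI)
  fix I
  define M where "M = (\<Sum>i = 1..l. replicate_mset (m i) (Lin i))"
  have eq: "Poly_Mapping.lookup (d * denom l m) (I + M) = Poly_Mapping.lookup d I"
    for d :: "gen multiset \<Rightarrow>\<^sub>0 'a::comm_ring_1"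
  proof -
    have *: "(\<Sum>q. ((1::'a) when M = q) when I + M = J + q) = (1 when J = I)"
      for J :: "gen multiset"
    proof -
      have "(\<Sum>q. ((1::'a) when M = q) when I + M = J + q) =
          (\<Sum>q. (1 when J = I) when q = M)"
        by (rule Sum_any.cong) (auto simp: when_def)
      then show ?thesis by simp
    qed
    show ?thesis
      unfolding denom_def M_def[symmetric] times_poly_mapping.rep_eq prod_fun_def lookup_single *
      by (simp add: mult_when)
  qed
  show "Poly_Mapping.lookup c I = Poly_Mapping.lookup c' I"
    using assms eq[of c] eq[of c'] by simp
qed

end

theory Submission
  imports Defs "HOL-Library.Countable" "HOL-Computational_Algebra.Polynomial_Factorial"
begin

text \<open>
  Since \<open>P\<^sub>r\<close> is linear in \<open>a\<^sub>r\<close> with coefficient a nonzero multiple of \<open>a\<^sub>0\<close> or \<open>a\<^sub>0\<^sup>2\<close>, and the mixed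
  forms are linear in \<open>a\<^bsub>1,i+1\<^esub>\<close> with coefficient \<open>a\<^bsub>0,i\<^esub>\<close>, the \<open>n - 1\<close> forms together with \<open>a\<^bsub>1,1\<^esub>\<close> are a
  triangular coordinate system once the \<open>a\<^bsub>0,i\<^esub>\<close> are inverted: they are algebraically independent and
  every polynomial becomes a polynomial in them after multiplication by powers of the \<open>a\<^bsub>0,i\<^esub>\<close>.  In
  these coordinates \<open>A\<close> scales the forms and sends \<open>a\<^bsub>1,1\<^esub>\<close> to \<open>\<lambda>\<^sub>1 (a\<^bsub>1,1\<^esub> + a\<^bsub>0,1\<^esub>)\<close>.  Comparing the two
  highest coefficients with respect to \<open>a\<^bsub>1,1\<^esub>\<close> shows that, in characteristic zero, a semi-invariant
  does not involve \<open>a\<^bsub>1,1\<^esub>\<close> and all its monomials have the same multiplier.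
\<close>

subsection \<open>The polynomials \<open>P\<^sub>r\<close>\<close>

text \<open>With \<open>E\<close> for the operator taking \<open>a s\<close> to
  \<open>a (s + 1)\<close>, this is \<open>(1 + E)^v\<close> applied to \<open>a\<close>. The sums
  over \<open>j\<close> in \<open>P_r\<close> are of this type, and the recursion suits differences
  better than explicit binomial coefficients.\<close>

primrec bsum :: "(nat \<Rightarrow> 'b::comm_ring_1) \<Rightarrow> nat \<Rightarrow> nat \<Rightarrow> 'b" where
  "bsum a 0 s = a s"
| "bsum a (Suc v) s = bsum a v s + bsum a v (Suc s)"

lemma bsum_eq_sum: "bsum a v s = (\<Sum>u\<le>v. of_nat (v choose u) * a (s + u))"
proof (induction v arbitrary: s)
  case (Suc v)
  have "(\<Sum>u\<le>Suc v. of_nat (Suc v choose u) * a (s + u)) =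
      a s + (\<Sum>u\<le>v. of_nat (v choose Suc u) * a (s + Suc u)) + (\<Sum>u\<le>v. of_nat (v choose u) * a (Suc s + u))"
    by (subst sum.atMost_Suc_shift) (simp add: algebra_simps sum.distrib)
  also have "a s + (\<Sum>u\<le>v. of_nat (v choose Suc u) * a (s + Suc u)) =
      (\<Sum>u\<le>Suc v. of_nat (v choose u) * a (s + u))"
    by (subst sum.atMost_Suc_shift) simp
  also have "\<dots> = bsum a v s"
    by (simp add: Suc binomial_eq_0)
  finally show ?case by (simp add: Suc)
qed simp

text \<open>Absorption \<open>u * (v choose u) = v * (v - 1 choose u - 1)\<close>. It handles the
  factor \<open>j - i\<close> of the odd forms; the truncated \<open>v - 1\<close> is harmless
  because of the factor \<open>v\<close>.\<close>

lemma bsum_weighted: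
  "(\<Sum>u\<le>v. of_nat (u * (v choose u)) * a (s + u)) = of_nat v * bsum a (v - 1) (Suc s)"
proof (cases v)
  case (Suc w)
  have "(\<Sum>u\<le>Suc w. of_nat (u * (Suc w choose u)) * a (s + u)) =
      (\<Sum>u\<le>w. of_nat (Suc u * (Suc w choose Suc u)) * a (s + Suc u))"
    by (subst sum.atMost_Suc_shift) simp
  also have "\<dots> = of_nat (Suc w) * (\<Sum>u\<le>w. of_nat (w choose u) * a (Suc s + u))"
    unfolding Suc_times_binomial by (simp only: of_nat_mult sum_distrib_left mult.assoc add_Suc add_Suc_right)
  finally show ?thesis
    unfolding Suc bsum_eq_sum by simp
qed simp

text \<open>The action of a multiplicative Jordan block with the eigenvalue divided out; the entry
  before position 0 counts as 0.\<close>

abbreviation shift :: "(nat \<Rightarrow> 'b::comm_ring_1) \<Rightarrow> nat \<Rightarrow> 'b" where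
  "shift a \<equiv> \<lambda>s. a s + (if s = 0 then 0 else a (s - 1))"

text \<open>Away from position 0, \<open>shift\<close> is \<open>1 + E^(-1)\<close>, and
  \<open>(1 + E)^v (1 + E^(-1)) = (1 + E)^(v + 1) E^(-1)\<close>.\<close>

lemma bsum_shift: "bsum (shift a) v (Suc s) = bsum a (Suc v) s"
  by (induction v arbitrary: s) (simp_all add: add.commute)

text \<open>Summation by parts: it moves \<open>shift\<close> from the factors \<open>a i\<close> to
  differences of the factors \<open>N i\<close>.\<close>

lemma alternating_sum_shift:
  "(\<Sum>i\<le>Suc n. (- 1) ^ i * shift a i * N i) =
    (\<Sum>i\<le>n. (- 1) ^ i * a i * (N i - N (Suc i))) + (- 1) ^ Suc n * a (Suc n) * (N (Suc n) :: 'b::comm_ring_1)"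
  by (induction n) (simp_all add: algebra_simps)

text \<open>For fixed \<open>i\<close> put \<open>j = m + u\<close>; each of the two binomial
  coefficients gives one iterated sum. At \<open>i = m\<close> the second coefficient is 0, whereas
  \<open>m - i - 1\<close> would truncate to 0 and leave a wrong term, hence the case
  distinction.\<close>

lemma P_even_eq:
  "P_even a m = (\<Sum>i\<le>m. (- 1) ^ i * a i *
     (bsum a (m - i) m + (if i < m then bsum a (m - i - 1) (Suc m) else 0)))"
proof -
  have "(\<Sum>j = m..2 * m - i. of_int ((- 1) ^ i *
          (zbinom (int m - int i) (int j - int m) +
           zbinom (int m - int i - 1) (int j - int m - 1))) * a i * a j) =
        (- 1) ^ i * a i * (bsum a (m - i) m + (if i < m then bsum a (m - i - 1) (Suc m) else 0))"
    (is "?L = _") if "i \<le> m" for i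
  proof -
    obtain v where m: "m = i + v" using le_Suc_ex[OF \<open>i \<le> m\<close>] by blast
    have "?L = (\<Sum>u\<le>v. of_int ((- 1) ^ i * (zbinom (int v) (int u) + zbinom (int v - 1) (int u - 1)))
              * a i * a (m + u))"
      by (rule sum.reindex_bij_witness[of _ "\<lambda>u. m + u" "\<lambda>j. j - m"]) (auto simp: m)
    also have "\<dots> = (- 1) ^ i * a i * ((\<Sum>u\<le>v. of_int (zbinom (int v) (int u)) * a (m + u)) +
        (\<Sum>u\<le>v. of_int (zbinom (int v - 1) (int u - 1)) * a (m + u)))"
      by (simp add: sum_distrib_left sum.distrib algebra_simps)
    also have "(\<Sum>u\<le>v. of_int (zbinom (int v) (int u)) * a (m + u)) = bsum a v m"
      unfolding bsum_eq_sum by (intro sum.cong) (auto simp: zbinom_def)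
    also have "(\<Sum>u\<le>v. of_int (zbinom (int v - 1) (int u - 1)) * a (m + u)) =
        (if 0 < v then bsum a (v - 1) (Suc m) else 0)"
    proof (cases v)
      case 0
      then show ?thesis by (simp add: zbinom_def)
    next
      case (Suc w)
      show ?thesis
        unfolding Suc bsum_eq_sum
        by (subst sum.atMost_Suc_shift) (auto simp: zbinom_def intro!: sum.cong)
    qed
    finally show ?thesis by (simp add: m)
  qed
  then show ?thesis
    unfolding P_even_def atLeast0AtMost by (intro sum.cong) auto
qed

text \<open>The double sum in \<open>P_r\<close> for \<open>r = 2 * n + 1\<close>, with opposite
  sign. Writing \<open>j - i = (n + 1 - i) + u\<close> for \<open>j = n + 1 + u\<close> splits it
  into the two summands.\<close>

definition Q_odd :: "(nat \<Rightarrow> 'b::comm_ring_1) \<Rightarrow> nat \<Rightarrow> 'b" where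
  "Q_odd a n = (\<Sum>i\<le>n. (- 1) ^ i * a i *
     (of_nat (Suc n - i) * bsum a (n - i) (Suc n) + of_nat (n - i) * bsum a (n - i - 1) (Suc (Suc n))))"

lemma P_odd_eq: "P_odd a (Suc n) = a 1 * P_even a n - a 0 * Q_odd a n"
proof -
  let ?m = "Suc n"
  have "(\<Sum>j = ?m..2 * ?m - 1 - i. of_int ((- 1) ^ (i + 1) * (int j - int i) *
          zbinom (int ?m - int i - 1) (int j - int ?m)) * a i * a j) =
        - ((- 1) ^ i * a i * (of_nat (Suc n - i) * bsum a (n - i) (Suc n) +
            of_nat (n - i) * bsum a (n - i - 1) (Suc (Suc n))))"
    (is "?L = _") if "i \<le> n" for i
  proof -
    obtain v where n: "n = i + v" using le_Suc_ex[OF \<open>i \<le> n\<close>] by blast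
    have "?L = (\<Sum>u\<le>v. of_int ((- 1) ^ (i + 1) * (int (Suc v) + int u) * zbinom (int v) (int u)) * a i
              * a (?m + u))"
      by (rule sum.reindex_bij_witness[of _ "\<lambda>u. ?m + u" "\<lambda>j. j - ?m"]) (auto simp: n)
    also have "\<dots> = (\<Sum>u\<le>v. - ((- 1) ^ i * a i * (of_nat (Suc v) * (of_nat (v choose u) * a (?m + u)) +
        of_nat (u * (v choose u)) * a (?m + u))))"
      by (intro sum.cong) (auto simp: zbinom_def algebra_simps)
    also have "\<dots> = - ((- 1) ^ i * a i * (of_nat (Suc v) * bsum a v ?m +
        (\<Sum>u\<le>v. of_nat (u * (v choose u)) * a (?m + u))))"
      unfolding bsum_eq_sum by (simp only: sum_negf sum.distrib flip: sum_distrib_left)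
    finally show ?thesis
      unfolding bsum_weighted by (simp add: n)
  qed
  then show ?thesis
    unfolding P_odd_def Q_odd_def atLeast0AtMost
    by (simp add: sum_negf flip: atLeast0AtMost)
qed

section \<open>Invariance of the forms \<open>P_r\<close> under the Jordan action\<close>

text \<open>Since \<open>(1 + E)^(v + 1) - (1 + E)^v = E (1 + E)^v\<close>, summation by parts turns
  the inner factor \<open>N\<close> of the shifted sequence back into the original one,
  \<open>O'\<close>.\<close>

lemma P_even_shift:
  assumes "1 \<le> m"
  shows "P_even (shift a) m = P_even a m"
proof -
  obtain n where m: "m = Suc n" using assms by (cases m) auto
  define N where "N i = bsum a (Suc (m - i)) n + (if i < m then bsum a (m - i) (Suc n) else 0)" for i
  define O' where "O' i = bsum a (m - i) m + (if i < m then bsum a (m - i - 1) (Suc m) else 0)" for i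
  have "P_even (shift a) m = (\<Sum>i\<le>m. (- 1) ^ i * shift a i * N i)"
    unfolding P_even_eq N_def unfolding m bsum_shift
    by (intro sum.cong refl arg_cong2[where f = "(*)"] arg_cong2[where f = "(+)"] if_cong)
      (auto simp: Suc_diff_le)
  also have "\<dots> = (\<Sum>i\<le>n. (- 1) ^ i * a i * (N i - N (Suc i))) + (- 1) ^ Suc n * a m * N m"
    unfolding m by (rule alternating_sum_shift)
  \<comment> \<open>The identity \<open>N i - N (Suc i) = O' i\<close> needs
    \<open>Suc i < m\<close>: at \<open>i = n\<close> the second summand of \<open>N m\<close> is
    missing. The terms with \<open>a n\<close> and \<open>a m\<close> therefore agree only
    jointly.\<close>
  also have "\<dots> = (\<Sum>i<n. (- 1) ^ i * a i * (N i - N (Suc i))) + (- 1) ^ n * (a n * (N n - N m) - a m * N m)"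
    by (simp add: m algebra_simps flip: lessThan_Suc_atMost)
  also have "(\<Sum>i<n. (- 1) ^ i * a i * (N i - N (Suc i))) = (\<Sum>i<n. (- 1) ^ i * a i * O' i)"
  proof (intro sum.cong refl arg_cong2[where f = "(*)"])
    fix i assume "i \<in> {..<n}"
    then obtain w where n: "n = Suc (i + w)" using less_iff_Suc_add by auto
    have [simp]: "Suc (i + w) - i = Suc w" "Suc (Suc (i + w)) - i = Suc (Suc w)" by auto
    show "N i - N (Suc i) = O' i"
      by (simp add: N_def O'_def m n)
  qed
  also have "a n * (N n - N m) - a m * N m = a n * O' n - a m * O' m"
    by (simp add: N_def O'_def m algebra_simps)
  also have "(\<Sum>i<n. (- 1) ^ i * a i * O' i) + (- 1) ^ n * (a n * O' n - a m * O' m) =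
      (\<Sum>i\<le>m. (- 1) ^ i * a i * O' i)"
    by (simp add: m algebra_simps flip: lessThan_Suc_atMost)
  also have "\<dots> = P_even a m"
    by (simp add: P_even_eq O'_def)
  finally show ?thesis .
qed

text \<open>The weights drop by one from \<open>i\<close> to \<open>i + 1\<close>, and this drop
  produces the extra \<open>P_even a n\<close>. The last term needs no separate treatment, as the
  weight \<open>n - i\<close> vanishes there.\<close>

lemma Q_odd_shift:
  assumes "1 \<le> n"
  shows "Q_odd (shift a) n = Q_odd a n + P_even a n"
proof -
  obtain k where n: "n = Suc k" using assms by (cases n) auto
  define N where "N i = of_nat (Suc n - i) * bsum a (Suc (n - i)) n + of_nat (n - i) * bsum a (n - i) (Suc n)" for i
  define O' where "O' i = of_nat (Suc n - i) * bsum a (n - i) (Suc n) + of_nat (n - i) * bsum a (n - i - 1) (Suc (Suc n))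
     + (bsum a (n - i) n + (if i < n then bsum a (n - i - 1) (Suc n) else 0))" for i
  \<comment> \<open>At \<open>n - i = 0\<close> truncation makes the two iterated sums differ, but
    their common factor is 0.\<close>
  have *: "of_nat (n - i) * bsum a (Suc (n - i - 1)) (Suc n) = of_nat (n - i) * bsum a (n - i) (Suc n)" for i
    by (cases "n - i") simp_all
  have "Q_odd (shift a) n = (\<Sum>i\<le>n. (- 1) ^ i * shift a i * N i)"
    unfolding Q_odd_def N_def bsum_shift * ..
  also have "\<dots> = (\<Sum>i\<le>k. (- 1) ^ i * a i * (N i - N (Suc i))) + (- 1) ^ Suc k * a n * N n"
    unfolding n by (rule alternating_sum_shift)
  also have "(\<Sum>i\<le>k. (- 1) ^ i * a i * (N i - N (Suc i))) = (\<Sum>i\<le>k. (- 1) ^ i * a i * O' i)"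
  proof (intro sum.cong refl arg_cong2[where f = "(*)"])
    fix i assume "i \<in> {..k}"
    then have "i \<le> k" by simp
    from le_Suc_ex[OF this] obtain w where k: "k = i + w" by blast
    have [simp]: "Suc (i + w) - i = Suc w" "Suc (Suc (i + w)) - i = Suc (Suc w)" by auto
    show "N i - N (Suc i) = O' i"
      by (simp add: N_def O'_def n k algebra_simps)
  qed
  also have "N n = O' n"
    by (simp add: N_def O'_def)
  also have "(\<Sum>i\<le>k. (- 1) ^ i * a i * O' i) + (- 1) ^ Suc k * a n * O' n = (\<Sum>i\<le>n. (- 1) ^ i * a i * O' i)"
    by (simp add: n)
  also have "\<dots> = Q_odd a n + P_even a n"
    unfolding Q_odd_def P_even_eq O'_def by (simp only: distrib_left sum.distrib)
  finally show ?thesis .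
qed

text \<open>For odd \<open>r\<close>, \<open>a 1\<close> gains \<open>a 0\<close>, which contributes
  \<open>a 0 * P_even a n\<close>; the gain of \<open>Q_odd\<close> in \<open>Q_odd_shift\<close>
  cancels exactly this.\<close>

lemma P_form_shift:
  assumes "2 \<le> r"
  shows "P_form (shift a) r = P_form a r"
proof (cases "even r")
  case True
  then show ?thesis using assms by (auto simp: P_form_def intro!: P_even_shift)
next
  case False
  then obtain n where r: "r = 2 * n + 1" using oddE by blast
  with assms have "1 \<le> n" by simp
  then show ?thesis
    by (simp add: P_form_def r P_odd_eq P_even_shift Q_odd_shift algebra_simps)
qed


section \<open>Scaling of \<open>P_r\<close> and the variables it involves\<close>

lemma P_even_scale: "P_even (\<lambda>s. c * a s) m = c ^ 2 * P_even a m"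
  by (simp add: P_even_def sum_distrib_left power2_eq_square ac_simps)

lemma P_odd_scale: "P_odd (\<lambda>s. c * a s) m = c ^ 3 * P_odd a m"
  unfolding P_odd_def P_even_scale distrib_left
  by (simp add: sum_distrib_left power2_eq_square power3_eq_cube ac_simps)

lemma P_form_scale: "P_form (\<lambda>s. c * a s) r = c ^ (if even r then 2 else 3) * P_form a r"
  by (simp add: P_form_def P_even_scale P_odd_scale)

lemma P_even_cong: "(\<And>s. s \<le> 2 * m \<Longrightarrow> a s = b s) \<Longrightarrow> P_even a m = P_even b m"
  by (auto simp: P_even_def intro!: sum.cong arg_cong2[where f = "(*)"])

lemma P_form_cong:
  assumes "\<And>s. s \<le> r \<Longrightarrow> a s = b s" "2 \<le> r"
  shows "P_form a r = P_form b r"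
proof (cases "even r")
  case True
  then show ?thesis using assms(1) by (auto simp: P_form_def intro!: P_even_cong)
next
  case False
  then obtain m where r: "r = 2 * m + 1" using oddE by blast
  have "P_even a m = P_even b m"
    by (rule P_even_cong) (simp add: assms r)
  moreover have "a i = b i" if "i \<le> Suc (2 * m)" for i
    using assms(1) that r by simp
  ultimately show ?thesis using assms(2)
    by (auto simp: P_form_def r P_odd_def intro!: sum.cong arg_cong2[where f = "(*)"] arg_cong2[where f = "(+)"])
qed

lemma (in comm_ring_hom) hom_P_form: "hom (P_form a r) = P_form (\<lambda>s. hom (a s)) r"
  by (simp add: P_form_def P_even_def P_odd_def hom_distribs)

section \<open>The term of \<open>P_r\<close> that contains \<open>a_r\<close>\<close>

text \<open>For \<open>r\<close> at least 2, the coefficient in \<open>P_r\<close> of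
  \<open>a 0 * a r\<close> (even \<open>r\<close>) or of \<open>a 0 ^ 2 * a r\<close> (odd
  \<open>r\<close>). It is an integer so that it makes sense in every ring involved.\<close>

definition P_lead :: "nat \<Rightarrow> int" where
  "P_lead r = (if even r then 2 else - int r)"

lemma P_lead_nonzero: "2 \<le> r \<Longrightarrow> P_lead r \<noteq> 0"
  by (auto simp: P_lead_def)

text \<open>As \<open>j\<close> is at most \<open>2 * m - i\<close>, the index \<open>2 * m\<close>
  occurs only for \<open>i = 0\<close> and \<open>j = 2 * m\<close>. Its coefficient is
  \<open>(m choose m) + (m - 1 choose m - 1) = 2\<close>.\<close>

lemma P_even_split:
  assumes "1 \<le> m"
  shows "P_even a m = P_even (a(2 * m := 0)) m + 2 * a 0 * a (2 * m)"
proof -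
  define t where "t b i j = (of_int ((- 1) ^ i *
          (zbinom (int m - int i) (int j - int m) +
           zbinom (int m - int i - 1) (int j - int m - 1))) * b i * b j :: 'a)" for b i j
  have "(\<Sum>j = m..2 * m - i. t a i j) =
      (\<Sum>j = m..2 * m - i. t (a(2 * m := 0)) i j) + (if i = 0 then 2 * a 0 * a (2 * m) else 0)"
    if "i \<le> m" for i
  proof (cases "i = 0")
    case False
    then show ?thesis using that by (auto simp: t_def intro!: sum.cong)
  next
    case True
    have "{m..2 * m} = insert (2 * m) {m..<2 * m}" using assms by auto
    moreover have "(\<Sum>j = m..<2 * m. t a 0 j) = (\<Sum>j = m..<2 * m. t (a(2 * m := 0)) 0 j)"
      using assms by (auto simp: t_def intro!: sum.cong)
    moreover have "t a 0 (2 * m) = 2 * a 0 * a (2 * m)"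
      using assms by (simp add: t_def zbinom_def)
    moreover have "t (a(2 * m := 0)) 0 (2 * m) = 0" by (simp add: t_def)
    ultimately show ?thesis using True by simp
  qed
  then have "(\<Sum>i = 0..m. \<Sum>j = m..2 * m - i. t a i j) =
    (\<Sum>i = 0..m. (\<Sum>j = m..2 * m - i. t (a(2 * m := 0)) i j) + (if i = 0 then 2 * a 0 * a (2 * m) else 0))"
    by (intro sum.cong) auto
  then show ?thesis
    unfolding P_even_def t_def by (simp add: sum.distrib)
qed

text \<open>Again only \<open>i = 0\<close> reaches the last index, with coefficient
  \<open>- (2 * n + 1)\<close>. The outer factor \<open>a 0\<close> makes the power a square, and
  \<open>P_even a n\<close> stops at index \<open>2 * n\<close>.\<close>

lemma P_odd_split:
  assumes "1 \<le> n"
  shows "P_odd a (Suc n) = P_odd (a(Suc (2 * n) := 0)) (Suc n) - of_nat (Suc (2 * n)) * a 0 ^ 2 * a (Suc (2 * n))"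
proof -
  let ?r = "Suc (2 * n)"
  define t where "t b i j = (of_int ((- 1) ^ (i + 1) * (int j - int i) *
      zbinom (int (Suc n) - int i - 1) (int j - int (Suc n))) * b i * b j :: 'a)" for b i j
  have "(\<Sum>j = Suc n..2 * Suc n - 1 - i. t a i j) =
      (\<Sum>j = Suc n..2 * Suc n - 1 - i. t (a(?r := 0)) i j) + (if i = 0 then - of_nat ?r * a 0 * a ?r else 0)"
    if "i \<le> n" for i
  proof (cases "i = 0")
    case False
    then show ?thesis using that by (auto simp: t_def intro!: sum.cong)
  next
    case True
    have "{Suc n..?r} = insert ?r {Suc n..<?r}" using assms by auto
    moreover have "(\<Sum>j = Suc n..<?r. t a 0 j) = (\<Sum>j = Suc n..<?r. t (a(?r := 0)) 0 j)"
      using assms by (auto simp: t_def intro!: sum.cong)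
    moreover have "t a 0 ?r = - of_nat ?r * a 0 * a ?r"
      using assms by (simp add: t_def zbinom_def algebra_simps)
    moreover have "t (a(?r := 0)) 0 ?r = 0" by (simp add: t_def)
    ultimately show ?thesis using True by simp
  qed
  then have "(\<Sum>i = 0..n. \<Sum>j = Suc n..2 * Suc n - 1 - i. t a i j) =
    (\<Sum>i = 0..n. (\<Sum>j = Suc n..2 * Suc n - 1 - i. t (a(?r := 0)) i j) + (if i = 0 then - of_nat ?r * a 0 * a ?r else 0))"
    by (intro sum.cong) auto
  also have "\<dots> = (\<Sum>i = 0..n. \<Sum>j = Suc n..2 * Suc n - 1 - i. t (a(?r := 0)) i j) - of_nat ?r * a 0 * a ?r"
    by (simp add: sum.distrib algebra_simps)
  finally have "a 0 * (\<Sum>i = 0..n. \<Sum>j = Suc n..2 * Suc n - 1 - i. t a i j) =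
      a 0 * (\<Sum>i = 0..n. \<Sum>j = Suc n..2 * Suc n - 1 - i. t (a(?r := 0)) i j) - of_nat ?r * a 0 ^ 2 * a ?r"
    by (simp only: right_diff_distrib power2_eq_square mult_ac)
  moreover have "P_even (a(?r := 0)) n = P_even a n"
    by (rule P_even_cong) simp
  ultimately show ?thesis
    unfolding P_odd_def t_def using assms by simp
qed

lemma P_form_split:
  assumes "2 \<le> r"
  shows "P_form a r = P_form (a(r := 0)) r + of_int (P_lead r) * a 0 ^ (if even r then 1 else 2) * a r"
proof (cases "even r")
  case True
  then obtain m where "r = 2 * m" by blast
  with assms show ?thesis using P_even_split[of m a] by (simp add: P_form_def P_lead_def)
next
  case False
  then obtain n where "r = 2 * n + 1" using oddE by blast
  with assms show ?thesis using P_odd_split[of n a]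
    by (simp add: P_form_def P_lead_def algebra_simps)
qed

subsection \<open>Evaluation\<close>

text \<open>Stated for any commutative monoid of monomials: exponent vectors for
  \<open>mpoly\<close>, and multisets of labels for formal expressions.\<close>

definition mext :: "('a::comm_ring_1 \<Rightarrow> 'b::comm_ring_1) \<Rightarrow> ('m::comm_monoid_add \<Rightarrow> 'b) \<Rightarrow> ('m \<Rightarrow>\<^sub>0 'a) \<Rightarrow> 'b" where
  "mext \<iota> \<phi> p = (\<Sum>t\<in>Poly_Mapping.keys p. \<iota> (Poly_Mapping.lookup p t) * \<phi> t)"

lemma poly_mapping_sum_single:
  fixes p :: "'m \<Rightarrow>\<^sub>0 'a::comm_monoid_add"
  shows "p = (\<Sum>t\<in>Poly_Mapping.keys p. Poly_Mapping.single t (Poly_Mapping.lookup p t))"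
  by (rule poly_mapping_eqI)
    (auto simp: lookup_sum lookup_single when_def in_keys_iff sum.delta)

lemma poly_mapping_induct [case_names zero add]:
  fixes P :: "('m \<Rightarrow>\<^sub>0 'a::comm_monoid_add) \<Rightarrow> bool"
  assumes "P 0" "\<And>t c p. P p \<Longrightarrow> P (p + Poly_Mapping.single t c)"
  shows "P p"
proof -
  have "P (\<Sum>t\<in>A. Poly_Mapping.single t (Poly_Mapping.lookup p t))" if "finite A" for A
    using that
    by induction (simp_all add: assms(1) assms(2) add.commute[of "Poly_Mapping.single _ _"])
  from this[OF finite_keys[of p]] show ?thesis
    by (simp flip: poly_mapping_sum_single)
qed

text \<open>The universal property of a monoid algebra: a ring homomorphism on coefficients and a
  monoid homomorphism on monomials extend to the whole algebra.\<close>

locale mon_eval = \<iota>: comm_ring_hom \<iota>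
  for \<iota> :: "'a::comm_ring_1 \<Rightarrow> 'b::comm_ring_1" +
  fixes \<phi> :: "'m::comm_monoid_add \<Rightarrow> 'b"
  assumes \<phi>_0 [simp]: "\<phi> 0 = 1" and \<phi>_add: "\<phi> (s + t) = \<phi> s * \<phi> t"
begin

text \<open>Keys can cancel under addition, so sums are compared over a common finite superset of
  the keys.\<close>

lemma mext_superset:
  assumes "finite A" "Poly_Mapping.keys p \<subseteq> A"
  shows "mext \<iota> \<phi> p = (\<Sum>t\<in>A. \<iota> (Poly_Mapping.lookup p t) * \<phi> t)"
  unfolding mext_def using assms
  by (intro sum.mono_neutral_left) (auto simp: in_keys_iff)

lemma mext_add: "mext \<iota> \<phi> (p + q) = mext \<iota> \<phi> p + mext \<iota> \<phi> q"
proof -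
  let ?A = "Poly_Mapping.keys p \<union> Poly_Mapping.keys q"
  have "mext \<iota> \<phi> r = (\<Sum>t\<in>?A. \<iota> (Poly_Mapping.lookup r t) * \<phi> t)" if "Poly_Mapping.keys r \<subseteq> ?A" for r
    by (rule mext_superset) (use that in auto)
  from this[of p] this[of q] this[OF Poly_Mapping.keys_add] show ?thesis
    by (simp add: lookup_add \<iota>.hom_add distrib_right sum.distrib)
qed

lemma mext_single [simp]: "mext \<iota> \<phi> (Poly_Mapping.single t c) = \<iota> c * \<phi> t"
  by (simp add: mext_def)

lemma mext_0 [simp]: "mext \<iota> \<phi> 0 = 0"
  by (simp add: mext_def)

lemma mext_mult: "mext \<iota> \<phi> (p * q) = mext \<iota> \<phi> p * mext \<iota> \<phi> q"
proof (induction p rule: poly_mapping_induct)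
  case (add t c p)
  have "mext \<iota> \<phi> (Poly_Mapping.single t c * q) = \<iota> c * \<phi> t * mext \<iota> \<phi> q"
    by (induction q rule: poly_mapping_induct)
      (simp_all add: mult_single mext_add distrib_left \<phi>_add \<iota>.hom_mult mult_ac)
  then show ?case
    using add by (simp add: mext_add distrib_right)
qed simp

sublocale ext: comm_ring_hom "mext \<iota> \<phi>"
proof
  have "mext \<iota> \<phi> 1 = mext \<iota> \<phi> (Poly_Mapping.single 0 1)" by simp
  then show "mext \<iota> \<phi> 1 = 1" by (simp del: single_one)
qed (simp_all add: mext_add mext_mult)

end

lemma (in comm_ring_hom) hom_mext:
  "hom (mext \<iota> \<phi> p) = mext (\<lambda>c. hom (\<iota> c)) (\<lambda>t. hom (\<phi> t)) p"
  by (simp add: mext_def hom_distribs)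

lemma comm_ring_hom_mconst: "comm_ring_hom (mconst :: 'a::comm_ring_1 \<Rightarrow> 'a mpoly)"
  by unfold_locales (simp_all add: mconst_def single_add mult_single)

lemma comm_ring_hom_single_0: "comm_ring_hom (Poly_Mapping.single 0 :: 'a::comm_ring_1 \<Rightarrow> 'm::comm_monoid_add \<Rightarrow>\<^sub>0 'a)"
  by unfold_locales (simp_all add: single_add mult_single)

definition mon_power :: "(nat \<Rightarrow> 'b::comm_ring_1) \<Rightarrow> (nat \<Rightarrow>\<^sub>0 nat) \<Rightarrow> 'b" where
  "mon_power f t = (\<Prod>v \<in> Poly_Mapping.keys t. f v ^ Poly_Mapping.lookup t v)"

lemma mon_power_superset:
  assumes "finite A" "Poly_Mapping.keys t \<subseteq> A"
  shows "mon_power f t = (\<Prod>v\<in>A. f v ^ Poly_Mapping.lookup t v)"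
  unfolding mon_power_def using assms
  by (intro prod.mono_neutral_left) (auto simp: in_keys_iff)

lemma mon_power_0 [simp]: "mon_power f 0 = 1"
  by (simp add: mon_power_def)

lemma mon_power_add: "mon_power f (s + t) = mon_power f s * mon_power f t"
proof -
  let ?A = "Poly_Mapping.keys s \<union> Poly_Mapping.keys t"
  have "mon_power f r = (\<Prod>v\<in>?A. f v ^ Poly_Mapping.lookup r v)" if "Poly_Mapping.keys r \<subseteq> ?A" for r
    by (rule mon_power_superset) (use that in auto)
  from this[of s] this[of t] this[OF Poly_Mapping.keys_add] show ?thesis
    by (simp add: lookup_add power_add prod.distrib)
qed

lemma mon_eval_mon_power: "comm_ring_hom \<iota> \<Longrightarrow> mon_eval \<iota> (mon_power f)"
  by (simp add: mon_eval_def mon_eval_axioms_def mon_power_add)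

lemma mon_eval_mset: "comm_ring_hom \<iota> \<Longrightarrow> mon_eval \<iota> (\<lambda>I. \<Prod>x\<in>#I. f x)"
  by (simp add: mon_eval_def mon_eval_axioms_def)

lemma msubst_eq_mext: "msubst f p = mext mconst (mon_power f) p"
  by (simp add: msubst_def mext_def mon_power_def)

interpretation msubst: comm_ring_hom "msubst f :: 'a mpoly \<Rightarrow> 'a::comm_ring_1 mpoly" for f
proof -
  interpret mon_eval mconst "mon_power f"
    by (rule mon_eval_mon_power[OF comm_ring_hom_mconst])
  show "comm_ring_hom (msubst f)"
    unfolding msubst_eq_mext[abs_def] by (rule ext.comm_ring_hom_axioms)
qed

lemma mon_power_single: "mon_power f (Poly_Mapping.single v 1) = f v"
  by (simp add: mon_power_def)

lemma msubst_mvar [simp]: "msubst f (mvar v) = f v"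
  by (simp add: msubst_def mvar_def mconst_def)

lemma msubst_mconst [simp]: "msubst f (mconst c) = mconst c"
  by (simp add: msubst_def mconst_def)

text \<open>The formal indeterminate of \<open>x\<close>, in the type in which
  \<open>expresses\<close> keeps its coefficient families; \<open>lsubst\<close> below substitutes
  for these indeterminates.\<close>

abbreviation lab :: "'x \<Rightarrow> 'x multiset \<Rightarrow>\<^sub>0 'a::comm_ring_1" where
  "lab x \<equiv> Poly_Mapping.single {#x#} 1"

abbreviation lsubst :: "('a::comm_ring_1 \<Rightarrow> 'b::comm_ring_1) \<Rightarrow> ('x \<Rightarrow> 'b) \<Rightarrow> ('x multiset \<Rightarrow>\<^sub>0 'a) \<Rightarrow> 'b" where
  "lsubst \<iota> f \<equiv> mext \<iota> (\<lambda>I. \<Prod>x\<in>#I. f x)"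

lemma single_replicate_mset: "Poly_Mapping.single (replicate_mset n x) (1 :: 'a::comm_ring_1) = lab x ^ n"
proof (induction n)
  case (Suc n)
  have "Poly_Mapping.single (replicate_mset (Suc n) x) (1::'a) = Poly_Mapping.single ({#x#} + replicate_mset n x) (1 * 1)"
    by simp
  also have "\<dots> = lab x * Poly_Mapping.single (replicate_mset n x) 1"
    by (simp only: mult_single)
  finally show ?case by (simp add: Suc)
qed simp

subsection \<open>Block diagonal matrices\<close>

text \<open>Induction on the list: peeling off the first block lowers row and column index by its
  size. Squareness of the blocks keeps row and column offsets equal.\<close>

lemma index_diag_block_mat:
  assumes "\<And>A. A \<in> set As \<Longrightarrow> dim_col A = dim_row A"
    and "i < length As" "s < dim_row (As ! i)" "c < (\<Sum>j<length As. dim_row (As ! j))"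
  shows "diag_block_mat As $$ ((\<Sum>j<i. dim_row (As ! j)) + s, c) =
    (if (\<Sum>j<i. dim_row (As ! j)) \<le> c \<and> c < (\<Sum>j<i. dim_row (As ! j)) + dim_row (As ! i)
     then As ! i $$ (s, c - (\<Sum>j<i. dim_row (As ! j))) else 0)"
  using assms
proof (induction As arbitrary: i c)
  case (Cons A As)
  let ?B = "diag_block_mat As"
  have sum_Suc: "(\<Sum>j<Suc i. dim_row ((A # As) ! j)) = dim_row A + (\<Sum>j<i. dim_row (As ! j))" for i
    unfolding sum.lessThan_Suc_shift by simp
  have dims: "dim_col A = dim_row A" "dim_row ?B = (\<Sum>j<length As. dim_row (As ! j))"
      "dim_col ?B = (\<Sum>j<length As. dim_row (As ! j))"
    using Cons.prems(1)
    by (auto simp: dim_diag_block_mat sum_list_sum_nth atLeast0LessThan intro!: sum.cong)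
  show ?case
  proof (cases i)
    case 0
    then show ?thesis
      using Cons.prems(3,4) dims unfolding list.size(4) One_nat_def add_Suc_right add_0_right sum_Suc
      by (auto simp: Let_def four_block_mat_def)
  next
    case (Suc i')
    have less: "(\<Sum>j<i'. dim_row (As ! j)) + s < (\<Sum>j<length As. dim_row (As ! j))"
    proof -
      have "(\<Sum>j<i'. dim_row (As ! j)) + s < (\<Sum>j<Suc i'. dim_row (As ! j))"
        using Cons.prems(3) Suc by simp
      also have "\<dots> \<le> (\<Sum>j<length As. dim_row (As ! j))"
        using Cons.prems(2) Suc by (intro sum_mono2) auto
      finally show ?thesis .
    qed
    have c: "c < dim_row A + (\<Sum>j<length As. dim_row (As ! j))"
      using Cons.prems(4) sum_Suc by simp
    show ?thesis
    proof (cases "c < dim_row A")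
      case True
      then show ?thesis
        unfolding Suc sum_Suc using less c dims by (simp add: Let_def)
    next
      case False
      then have "diag_block_mat (A # As) $$ (dim_row A + (\<Sum>j<i'. dim_row (As ! j)) + s, c) =
          ?B $$ ((\<Sum>j<i'. dim_row (As ! j)) + s, c - dim_row A)"
        using less c dims by (simp add: Let_def)
      also have "\<dots> = (if (\<Sum>j<i'. dim_row (As ! j)) \<le> c - dim_row A \<and>
            c - dim_row A < (\<Sum>j<i'. dim_row (As ! j)) + dim_row (As ! i')
          then As ! i' $$ (s, c - dim_row A - (\<Sum>j<i'. dim_row (As ! j))) else 0)"
        using Cons.prems Suc c False by (intro Cons.IH) auto
      finally show ?thesis
        unfolding Suc sum_Suc using False by auto
    qed
  qed
qed simp

text \<open>The position of the first variable of block \<open>i\<close>; thus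
  \<open>offset ns (Suc k)\<close> is the number \<open>n\<close> of all variables.\<close>

definition offset :: "(nat \<Rightarrow> nat) \<Rightarrow> nat \<Rightarrow> nat" where
  "offset ns i = (\<Sum>t\<in>{1..<i}. ns t)"

lemma offset_Suc: "1 \<le> i \<Longrightarrow> offset ns (Suc i) = offset ns i + ns i"
  by (simp add: offset_def)

lemma offset_mono: "i \<le> j \<Longrightarrow> offset ns i \<le> offset ns j"
  unfolding offset_def by (intro sum_mono2) auto

lemma offset_less:
  assumes "1 \<le> i" "i \<le> k" "s < ns i"
  shows "offset ns i + s < offset ns (Suc k)"
proof -
  have "offset ns i + s < offset ns (Suc i)" using assms by (simp add: offset_Suc)
  also have "\<dots> \<le> offset ns (Suc k)" using assms by (intro offset_mono) simp
  finally show ?thesis .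
qed

lemma offset_inj:
  assumes "1 \<le> i" "1 \<le> j" "s < ns i" "t < ns j" "offset ns i + s = offset ns j + t"
  shows "i = j \<and> s = t"
proof -
  have "\<not> i < j" if "1 \<le> i" "s < ns i" "offset ns i + s = offset ns j + t" for i j s t
    using offset_less[of i "j - 1" s ns] that by (cases j) auto
  from this[of i s j t] this[of j t i s] assms show ?thesis by auto
qed

lemma offset_cases:
  assumes "v < offset ns (Suc k)"
  obtains i s where "1 \<le> i" "i \<le> k" "s < ns i" "v = offset ns i + s"
proof -
  have "\<exists>i s. 1 \<le> i \<and> i \<le> k \<and> s < ns i \<and> v = offset ns i + s"
    using assms
  proof (induction k)
    case (Suc k)
    show ?case
    proof (cases "v < offset ns (Suc k)")
      case True
      from Suc.IH[OF this] show ?thesis by (metis le_Suc_eq)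
    next
      case False
      with Suc.prems show ?thesis
        by (intro exI[of _ "Suc k"] exI[of _ "v - offset ns (Suc k)"])
          (auto simp: offset_Suc)
    qed
  qed (simp add: offset_def)
  then show ?thesis using that by blast
qed

lemma avar_eq: "avar ns s i = mvar (offset ns i + s)"
  by (simp add: avar_def offset_def)

lemma sum_lessThan_blocks: "(\<Sum>j<i. ns (Suc j)) = offset ns (Suc i)"
  unfolding offset_def by (rule sum.reindex_bij_witness[of _ "\<lambda>j. j - 1" Suc]) auto

lemma dim_jordan_diag [simp]:
  "dim_row (jordan_diag k ns lam) = offset ns (Suc k)"
  "dim_col (jordan_diag k ns lam) = offset ns (Suc k)"
  by (simp_all add: jordan_diag_def dim_diag_block_mat sum_list_sum_nth mult_jordan_block_def
      atLeast0LessThan flip: sum_lessThan_blocks cong: sum.cong_simp del: upt_Suc)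

lemma jordan_diag_index:
  assumes "1 \<le> i" "i \<le> k" "s < ns i" "c < offset ns (Suc k)"
  shows "jordan_diag k ns lam $$ (offset ns i + s, c) =
    (if c = offset ns i + s \<or> 0 < s \<and> c = offset ns i + (s - 1) then lam i else 0)"
proof -
  define As where "As = map (\<lambda>i. mult_jordan_block (ns i) (lam i)) [1..<Suc k]"
  \<comment> \<open>List positions start at 0, block numbers at 1.\<close>
  obtain i' where i: "i = Suc i'" using assms by (cases i) auto
  have As: "length As = k" "\<And>j. j < k \<Longrightarrow> As ! j = mult_jordan_block (ns (Suc j)) (lam (Suc j))"
    by (auto simp: As_def simp del: upt_Suc)
  have dim: "dim_row (As ! j) = ns (Suc j)" if "j < k" for j
    using As that by (simp add: mult_jordan_block_def)
  have off: "(\<Sum>j<l. dim_row (As ! j)) = offset ns (Suc l)" if "l \<le> k" for l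
    unfolding sum_lessThan_blocks[symmetric] using that by (intro sum.cong) (auto simp: dim)
  have "diag_block_mat As $$ ((\<Sum>j<i'. dim_row (As ! j)) + s, c) =
    (if (\<Sum>j<i'. dim_row (As ! j)) \<le> c \<and> c < (\<Sum>j<i'. dim_row (As ! j)) + dim_row (As ! i')
     then As ! i' $$ (s, c - (\<Sum>j<i'. dim_row (As ! j))) else 0)"
  proof (rule index_diag_block_mat)
    show "dim_col A = dim_row A" if "A \<in> set As" for A
      using that by (auto simp: As_def mult_jordan_block_def)
  qed (use assms i As(1) dim[of i'] off[of k] in auto)
  moreover have "(\<Sum>j<i'. dim_row (As ! j)) = offset ns i" "dim_row (As ! i') = ns i"
    "As ! i' = mult_jordan_block (ns i) (lam i)"
    using off[of i'] dim[of i'] As(2)[of i'] assms i by auto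
  moreover have "jordan_diag k ns lam = diag_block_mat As"
    by (simp add: jordan_diag_def As_def del: upt_Suc)
  ultimately show ?thesis
    using assms by (auto simp: mult_jordan_block_def)
qed

lemma mat_act_jordan_diag:
  fixes lam :: "nat \<Rightarrow> 'a::comm_ring_1"
  assumes "1 \<le> i" "i \<le> k" "s < ns i"
  shows "mat_act (jordan_diag k ns lam) (offset ns i + s) =
    mconst (lam i) * shift (\<lambda>s. avar ns s i) s"
proof -
  interpret mconst: comm_ring_hom "mconst :: 'a \<Rightarrow> 'a mpoly" by (rule comm_ring_hom_mconst)
  let ?n = "offset ns (Suc k)"
  have less: "offset ns i + s < ?n" "offset ns i + (s - 1) < ?n"
    using offset_less[of i k s ns] offset_less[of i k "s - 1" ns] assms by auto
  \<comment> \<open>At \<open>s = 0\<close> the truncated \<open>s - 1\<close> makes both indices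
    coincide, so the second summand needs the guard \<open>0 < s\<close>.\<close>
  have "mat_act (jordan_diag k ns lam) (offset ns i + s) =
      (\<Sum>c<?n. (if c = offset ns i + s then mconst (lam i) * mvar c else 0) +
        (if c = offset ns i + (s - 1) then (if 0 < s then mconst (lam i) * mvar c else 0) else 0))"
    unfolding mat_act_def dim_jordan_diag using assms
    by (intro sum.cong) (auto simp: jordan_diag_index)
  also have "\<dots> = mconst (lam i) * shift (\<lambda>s. avar ns s i) s"
    using less by (auto simp: sum.distrib avar_eq algebra_simps)
  finally show ?thesis .
qed

subsection \<open>The generators\<close>

text \<open>Applied to three sets: polynomials in the first \<open>n\<close> variables,
  \<open>labelled X\<close> and \<open>localized\<close>.\<close>

definition subring_set :: "'b::comm_ring_1 set \<Rightarrow> bool" where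
  "subring_set R \<longleftrightarrow> 0 \<in> R \<and> 1 \<in> R \<and> (\<forall>x\<in>R. - x \<in> R) \<and> (\<forall>x\<in>R. \<forall>y\<in>R. x + y \<in> R \<and> x * y \<in> R)"

lemma subring_setD:
  assumes "subring_set R"
  shows "0 \<in> R" "1 \<in> R" "x \<in> R \<Longrightarrow> - x \<in> R" "x \<in> R \<Longrightarrow> y \<in> R \<Longrightarrow> x + y \<in> R"
    "x \<in> R \<Longrightarrow> y \<in> R \<Longrightarrow> x * y \<in> R" "x \<in> R \<Longrightarrow> y \<in> R \<Longrightarrow> x - y \<in> R"
proof -
  show "x - y \<in> R" if "x \<in> R" "y \<in> R"
    using assms that unfolding subring_set_def diff_conv_add_uminus by blast
qed (use assms in \<open>auto simp: subring_set_def\<close>)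

lemma subring_set_sum: "subring_set R \<Longrightarrow> (\<And>x. x \<in> A \<Longrightarrow> f x \<in> R) \<Longrightarrow> sum f A \<in> R"
  by (induction A rule: infinite_finite_induct) (auto simp: subring_setD)

lemma subring_set_prod: "subring_set R \<Longrightarrow> (\<And>x. x \<in> A \<Longrightarrow> f x \<in> R) \<Longrightarrow> prod f A \<in> R"
  by (induction A rule: infinite_finite_induct) (auto simp: subring_setD)

lemma subring_set_prod_mset: "subring_set R \<Longrightarrow> (\<And>x. x \<in># A \<Longrightarrow> f x \<in> R) \<Longrightarrow> (\<Prod>x\<in>#A. f x) \<in> R"
  by (induction A) (auto simp: subring_setD)

lemma subring_set_power: "subring_set R \<Longrightarrow> x \<in> R \<Longrightarrow> x ^ n \<in> R"
  by (induction n) (auto simp: subring_setD)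

lemma subring_set_of_nat: "subring_set R \<Longrightarrow> of_nat n \<in> R"
  by (induction n) (auto simp: subring_setD)

lemma subring_set_of_int: "subring_set R \<Longrightarrow> of_int n \<in> R"
  by (cases n rule: int_cases2) (auto simp: subring_setD subring_set_of_nat)

lemma subring_set_P_form:
  assumes R: "subring_set R" and "2 \<le> r" "\<And>s. s \<le> r \<Longrightarrow> a s \<in> R"
  shows "P_form a r \<in> R"
proof -
  \<comment> \<open>Only the values up to \<open>r\<close> are known to lie in \<open>R\<close>;
    replacing the others by 0 leaves \<open>P_form\<close> unchanged.\<close>
  define b where "b s = (if s \<le> r then a s else 0)" for s
  have b: "b s \<in> R" for s using assms(3) subring_setD(1)[OF R] by (simp add: b_def)
  have "P_form b r \<in> R"
    unfolding P_form_def P_even_def P_odd_def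
    by (auto intro!: subring_setD[OF R] subring_set_sum[OF R] subring_set_of_int[OF R] b simp del: of_int_mult of_int_add)
  moreover have "P_form b r = P_form a r"
    using \<open>2 \<le> r\<close> by (intro P_form_cong) (auto simp: b_def)
  ultimately show ?thesis by simp
qed

lemma subring_set_poly_in: "subring_set {p :: 'a::comm_ring_1 mpoly. poly_in n p}"
proof -
  have add: "poly_in n (p + q)" if "poly_in n p" "poly_in n q" for p q :: "'a mpoly"
    using that Poly_Mapping.keys_add[of p q] unfolding poly_in_def by blast
  have mult: "poly_in n (p * q)" if "poly_in n p" "poly_in n q" for p q :: "'a mpoly"
    unfolding poly_in_def
  proof
    fix t assume "t \<in> Poly_Mapping.keys (p * q)"
    then obtain u v where "t = u + v" "u \<in> Poly_Mapping.keys p" "v \<in> Poly_Mapping.keys q"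
      using keys_mult[of p q] by auto
    then show "Poly_Mapping.keys t \<subseteq> {..<n}"
      using that Poly_Mapping.keys_add[of u v] unfolding poly_in_def by blast
  qed
  have uminus: "poly_in n (- p)" if "poly_in n p" for p :: "'a mpoly"
    using that by (simp add: poly_in_def in_keys_iff)
  have "poly_in n (0 :: 'a mpoly)" "poly_in n (1 :: 'a mpoly)"
    by (simp_all add: poly_in_def)
  then show ?thesis
    unfolding subring_set_def mem_Collect_eq by (intro conjI ballI add mult uminus) auto
qed

lemma poly_in_mvar: "v < n \<Longrightarrow> poly_in n (mvar v)"
  by (simp add: poly_in_def mvar_def)

section \<open>Degrees and homogeneity\<close>

definition monom_degree :: "(nat \<Rightarrow>\<^sub>0 nat) \<Rightarrow> nat" where
  "monom_degree t = (\<Sum>v \<in> Poly_Mapping.keys t. Poly_Mapping.lookup t v)"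

lemma monom_degree_add: "monom_degree (s + t) = monom_degree s + monom_degree t"
proof -
  let ?A = "Poly_Mapping.keys s \<union> Poly_Mapping.keys t"
  have "monom_degree r = (\<Sum>v\<in>?A. Poly_Mapping.lookup r v)" if "Poly_Mapping.keys r \<subseteq> ?A" for r
    unfolding monom_degree_def using that
    by (intro sum.mono_neutral_left) (auto simp: in_keys_iff)
  from this[of s] this[of t] this[OF Poly_Mapping.keys_add] show ?thesis
    by (simp add: lookup_add sum.distrib)
qed

definition homog :: "nat \<Rightarrow> 'a::zero mpoly \<Rightarrow> bool" where
  "homog d p \<longleftrightarrow> (\<forall>t \<in> Poly_Mapping.keys p. monom_degree t = d)"

lemma homog_imp_homogeneous: "homog d p \<Longrightarrow> homogeneous p"
  unfolding homog_def homogeneous_def monom_degree_def by (rule exI)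

lemma homog_0 [simp]: "homog d 0"
  by (simp add: homog_def)

lemma homog_mvar: "homog 1 (mvar v)"
  by (simp add: homog_def mvar_def monom_degree_def)

lemma homog_add: "homog d p \<Longrightarrow> homog d q \<Longrightarrow> homog d (p + q)"
  for p q :: "'a::comm_ring_1 mpoly"
  unfolding homog_def using subsetD[OF Poly_Mapping.keys_add[of p q]] by blast

lemma homog_diff: "homog d p \<Longrightarrow> homog d q \<Longrightarrow> homog d (p - q)"
  for p q :: "'a::comm_ring_1 mpoly"
proof -
  assume *: "homog d p" "homog d q"
  then have "homog d (- q)" by (simp add: homog_def in_keys_iff)
  with * homog_add[of d p "- q"] show ?thesis by simp
qed

lemma homog_mult: "homog d p \<Longrightarrow> homog e q \<Longrightarrow> homog (d + e) (p * q)"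
  for p q :: "'a::comm_ring_1 mpoly"
proof -
  assume *: "homog d p" "homog e q"
  have "monom_degree t = d + e" if "t \<in> Poly_Mapping.keys (p * q)" for t
  proof -
    obtain u v where "t = u + v" "u \<in> Poly_Mapping.keys p" "v \<in> Poly_Mapping.keys q"
      using keys_mult[of p q] \<open>t \<in> _\<close> by auto
    with * show ?thesis by (simp add: homog_def monom_degree_add)
  qed
  then show ?thesis by (simp add: homog_def)
qed

lemma homog_sum: "(\<And>x. x \<in> A \<Longrightarrow> homog d (f x)) \<Longrightarrow> homog d (sum f A)"
  for f :: "'b \<Rightarrow> 'a::comm_ring_1 mpoly"
  by (induction A rule: infinite_finite_induct) (auto intro: homog_add)

lemma homog_of_int: "homog 0 (of_int n :: 'a::comm_ring_1 mpoly)"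
  by (auto simp: homog_def in_keys_iff lookup_of_int monom_degree_def when_def split: if_splits)

lemma homog_P_form:
  fixes a :: "nat \<Rightarrow> 'a::comm_ring_1 mpoly"
  assumes a: "\<And>s. homog 1 (a s)"
  shows "homog (if even r then 2 else 3) (P_form a r)"
proof -
  have quad: "homog 2 (of_int z * a i * a j)" for z i j
    using homog_mult[OF homog_mult[OF homog_of_int a] a] by (simp add: numeral_2_eq_2)
  have cub: "homog 3 (a i * q)" if "homog 2 q" for i q
    using homog_mult[OF a that] by (simp add: numeral_3_eq_3 numeral_2_eq_2)
  show ?thesis
  proof (cases "even r")
    case True
    show ?thesis
      unfolding P_form_def P_even_def by (simp only: True if_True) (intro homog_sum quad)
  next
    case False
    show ?thesis
      unfolding P_form_def P_even_def P_odd_def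
      by (simp only: False if_False) (intro homog_add cub homog_sum quad)
  qed
qed

locale jordan_data =
  fixes lam :: "nat \<Rightarrow> 'a::field_char_0" and ns :: "nat \<Rightarrow> nat" and k l :: nat
  assumes l_pos: "0 < l" and l_le_k: "l \<le> k"
    and ns_ge_2: "\<And>i. 1 \<le> i \<Longrightarrow> i \<le> l \<Longrightarrow> 2 \<le> ns i"
    and ns_eq_1: "\<And>i. l < i \<Longrightarrow> i \<le> k \<Longrightarrow> ns i = 1"
    and lam_nonzero: "\<And>i. 1 \<le> i \<Longrightarrow> i \<le> k \<Longrightarrow> lam i \<noteq> 0"
begin

abbreviation "A \<equiv> jordan_diag k ns lam"

lemma ns_pos: "1 \<le> i \<Longrightarrow> i \<le> k \<Longrightarrow> 0 < ns i"
  using ns_ge_2[of i] ns_eq_1[of i] by (cases "i \<le> l") auto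

lemma ns_ge_3D: "i \<le> k \<Longrightarrow> 3 \<le> ns i \<Longrightarrow> i \<le> l"
  using ns_eq_1[of i] by (cases "i \<le> l") auto

text \<open>The three kinds of labels number \<open>k\<close>, the sum of \<open>ns i - 2\<close>
  over \<open>i <= l\<close>, and \<open>l - 1\<close>; each block after \<open>l\<close>
  contributes 1 to \<open>n\<close>.\<close>

lemma card_gens: "card (gens k l ns) = (\<Sum>i = 1..k. ns i) - 1"
proof -
  \<comment> \<open>A block of size at least 3 has index at most \<open>l\<close>, and size 2 gives
    an empty range, so these are all the \<open>Blk\<close> labels.\<close>
  let ?B = "(\<lambda>(i, r). Blk i r) ` (SIGMA i:{1..l}. {2..<ns i})"
  have "{Blk i r | i r. i \<in> {1..k} \<and> 3 \<le> ns i \<and> 2 \<le> r \<and> r \<le> ns i - 1} = ?B"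
    using l_le_k by (force dest: ns_ge_3D simp: image_iff)
  then have "gens k l ns = Lin ` {1..k} \<union> ?B \<union> Mix ` {1..<l}"
    by (simp add: gens_def)
  moreover have "card (Lin ` {1..k} \<union> ?B \<union> Mix ` {1..<l}) =
      card (Lin ` {1..k}) + card ?B + card (Mix ` {1..<l})"
    by (subst card_Un_disjoint; (subst card_Un_disjoint)?) auto
  moreover have "card (Lin ` {1..k}) = k" "card (Mix ` {1..<l}) = l - 1"
    by (simp_all add: card_image inj_on_def)
  moreover have "card ?B = (\<Sum>i = 1..l. ns i - 2)"
    by (subst card_image) (auto simp: inj_on_def)
  moreover have "(\<Sum>i = 1..l. ns i) = (\<Sum>i = 1..l. ns i - 2) + 2 * l"
  proof -
    have "(\<Sum>i = 1..l. ns i) = (\<Sum>i = 1..l. (ns i - 2) + 2)"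
    proof (intro sum.cong refl)
      fix i assume "i \<in> {1..l}"
      with ns_ge_2[of i] show "ns i = (ns i - 2) + 2" by auto
    qed
    then show ?thesis by (simp only: sum.distrib) simp
  qed
  moreover have "(\<Sum>i = 1..k. ns i) = (\<Sum>i = 1..l. ns i) + (k - l)"
  proof -
    have "{1..k} = {1..l} \<union> {l<..k}" using l_le_k l_pos by auto
    then have "(\<Sum>i = 1..k. ns i) = (\<Sum>i = 1..l. ns i) + (\<Sum>i \<in> {l<..k}. ns i)"
      by (simp add: sum.union_disjoint ivl_disj_int)
    also have "(\<Sum>i \<in> {l<..k}. ns i) = (\<Sum>i \<in> {l<..k}. 1)"
      by (intro sum.cong) (auto simp: ns_eq_1)
    finally show ?thesis by simp
  qed
  ultimately show ?thesis using l_pos l_le_k by simp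
qed

lemma gens_cases [consumes 1, case_names Lin Blk Mix]:
  assumes "x \<in> gens k l ns"
  obtains i where "x = Lin i" "1 \<le> i" "i \<le> k"
  | i r where "x = Blk i r" "1 \<le> i" "i \<le> l" "i \<le> k" "2 \<le> r" "r < ns i"
  | i where "x = Mix i" "1 \<le> i" "i < l"
  using assms
  unfolding gens_def
proof (elim UnE imageE CollectE exE conjE)
  fix i r assume "x = Blk i r" "i \<in> {1..k}" "3 \<le> ns i" "2 \<le> r" "r \<le> ns i - 1"
  with ns_ge_3D[of i] show ?thesis by (intro that(2)[of i r]) auto
qed (use that(1,3) in auto)

lemma homogeneous_gen_form:
  "homogeneous (gen_form ns x :: 'a mpoly)"
proof (cases x)
  case (Lin i)
  then show ?thesis by (auto simp: avar_def intro: homog_imp_homogeneous homog_mvar)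
next
  case (Blk i r)
  then show ?thesis by (auto simp: avar_def intro!: homog_imp_homogeneous homog_P_form homog_mvar)
next
  case (Mix i)
  have "homog (1 + 1) (avar ns 0 i * avar ns 1 (i + 1) - avar ns 1 i * avar ns 0 (i + 1) :: 'a mpoly)"
    unfolding avar_def by (intro homog_diff homog_mult homog_mvar)
  then show ?thesis by (simp add: Mix homog_imp_homogeneous)
qed

lemma poly_in_avar: "1 \<le> i \<Longrightarrow> i \<le> k \<Longrightarrow> s < ns i \<Longrightarrow> poly_in (offset ns (Suc k)) (avar ns s i)"
  unfolding avar_eq by (intro poly_in_mvar offset_less)

lemma poly_in_gen_form:
  assumes "x \<in> gens k l ns"
  shows "poly_in (offset ns (Suc k)) (gen_form ns x :: 'a mpoly)"
proof -
  note R = subring_set_poly_in[of "offset ns (Suc k)", where 'a = 'a]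
  from assms show ?thesis
  proof (cases rule: gens_cases)
    case (Lin i)
    then show ?thesis using ns_pos by (simp add: poly_in_avar)
  next
    case (Blk i r)
    then show ?thesis
      using subring_set_P_form[OF R, of r "\<lambda>s. avar ns s i :: 'a mpoly"] by (simp add: poly_in_avar)
  next
    case (Mix i)
    then have "2 \<le> ns i" "2 \<le> ns (Suc i)" using ns_ge_2 by auto
    with Mix l_le_k show ?thesis
      using subring_setD(5,6)[OF R] by (simp add: poly_in_avar)
  qed
qed

sublocale mconst: comm_ring_hom "mconst :: 'a \<Rightarrow> 'a mpoly"
  by (rule comm_ring_hom_mconst)

lemma msubst_avar:
  assumes "1 \<le> i" "i \<le> k" "s < ns i"
  shows "msubst (mat_act A) (avar ns s i) = mconst (lam i) * shift (\<lambda>s. avar ns s i) s"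
  using mat_act_jordan_diag[of i k s ns lam] assms by (simp add: avar_eq)

text \<open>The first variable of a block is only scaled. For \<open>Blk\<close>, shift invariance
  combines with scaling. For \<open>Mix\<close>, the extra products of \<open>a_{0,i}\<close> and
  \<open>a_{0,i+1}\<close> cancel in the determinant.\<close>

lemma msubst_gen_form:
  assumes "x \<in> gens k l ns"
  shows "msubst (mat_act A) (gen_form ns x) = mconst (gen_mult lam x) * gen_form ns x"
  using assms
proof (cases rule: gens_cases)
  case (Lin i)
  then show ?thesis using ns_pos by (simp add: msubst_avar)
next
  case (Blk i r)
  have "msubst (mat_act A) (P_form (\<lambda>s. avar ns s i) r) =
      P_form (\<lambda>s. mconst (lam i) * shift (\<lambda>s. avar ns s i) s) r"
    unfolding msubst.hom_P_form using Blk by (intro P_form_cong) (auto simp: msubst_avar)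
  then show ?thesis
    using Blk P_form_shift[of r "\<lambda>s. avar ns s i :: 'a mpoly"]
    by (simp add: P_form_scale mconst.hom_power)
next
  case (Mix i)
  then have "2 \<le> ns i" "2 \<le> ns (Suc i)" using ns_ge_2 by auto
  with Mix l_le_k show ?thesis
    by (simp add: msubst_avar msubst.hom_minus msubst.hom_mult mconst.hom_mult algebra_simps)
qed

lemma semi_invariant_gen_form:
  "x \<in> gens k l ns \<Longrightarrow> semi_invariant A (gen_mult lam x) (gen_form ns x)"
  by (simp add: semi_invariant_def poly_in_gen_form msubst_gen_form)

end

subsection \<open>Localisation\<close>

definition labelled :: "'x set \<Rightarrow> ('x multiset \<Rightarrow>\<^sub>0 'a::comm_ring_1) set" where
  "labelled X = {F. \<forall>I \<in> Poly_Mapping.keys F. set_mset I \<subseteq> X}"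

lemma labelled_single: "set_mset I \<subseteq> X \<Longrightarrow> Poly_Mapping.single I c \<in> labelled X"
  by (simp add: labelled_def)

lemma labelled_mono: "X \<subseteq> Y \<Longrightarrow> labelled X \<subseteq> labelled Y"
  by (auto simp: labelled_def)

lemma subring_set_labelled: "subring_set (labelled X :: ('x multiset \<Rightarrow>\<^sub>0 'a::comm_ring_1) set)"
proof -
  have add: "F + H \<in> labelled X" if "F \<in> labelled X" "H \<in> labelled X" for F H :: "'x multiset \<Rightarrow>\<^sub>0 'a"
    using that Poly_Mapping.keys_add[of F H] unfolding labelled_def by blast
  have mult: "F * H \<in> labelled X" if "F \<in> labelled X" "H \<in> labelled X" for F H :: "'x multiset \<Rightarrow>\<^sub>0 'a"
    unfolding labelled_def mem_Collect_eq
  proof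
    fix I assume "I \<in> Poly_Mapping.keys (F * H)"
    then obtain J K where "I = J + K" "J \<in> Poly_Mapping.keys F" "K \<in> Poly_Mapping.keys H"
      using keys_mult[of F H] by auto
    then show "set_mset I \<subseteq> X"
      using that unfolding labelled_def by auto
  qed
  have uminus: "- F \<in> labelled X" if "F \<in> labelled X" for F :: "'x multiset \<Rightarrow>\<^sub>0 'a"
    using that by (simp add: labelled_def in_keys_iff)
  have "(0 :: 'x multiset \<Rightarrow>\<^sub>0 'a) \<in> labelled X" "(1 :: 'x multiset \<Rightarrow>\<^sub>0 'a) \<in> labelled X"
    by (simp_all add: labelled_def)
  then show ?thesis
    unfolding subring_set_def by (intro conjI ballI add mult uminus) auto
qed

lemma lsubst_labelled_cong:
  "F \<in> labelled X \<Longrightarrow> (\<And>x. x \<in> X \<Longrightarrow> f x = g x) \<Longrightarrow> (\<And>c. \<iota> c = \<iota>' c) \<Longrightarrow> lsubst \<iota> f F = lsubst \<iota>' g F"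
  unfolding mext_def labelled_def
  by (intro sum.cong refl arg_cong2[where f = "(*)"] arg_cong[where f = prod_mset] image_mset_cong) auto

lemma lsubst_lab [simp]: "comm_ring_hom \<iota> \<Longrightarrow> lsubst \<iota> f (lab x) = f x"
proof -
  assume "comm_ring_hom \<iota>"
  then interpret comm_ring_hom \<iota> .
  show ?thesis by (simp add: mext_def)
qed

lemma single_sum: "Poly_Mapping.single (\<Sum>i\<in>A. f i) (1 :: 'a::comm_ring_1) = (\<Prod>i\<in>A. Poly_Mapping.single (f i) 1)"
  by (induction A rule: infinite_finite_induct) (simp_all flip: mult_single[where a = "1::'a" and b = "1::'a", simplified])

lemma denom_eq: "denom l m = (\<Prod>i = 1..l. lab (Lin i) ^ m i)"
  unfolding denom_def single_sum single_replicate_mset ..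

lemma denom_mult: "denom l m * denom l m' = denom l (\<lambda>i. m i + m' i)"
  by (simp add: denom_eq power_add prod.distrib)

lemma single_eq_mon_power: "Poly_Mapping.single t (c :: 'a::comm_ring_1) = mconst c * mon_power mvar t"
proof (induction t rule: poly_mapping_induct)
  case (add v n t)
  have pow: "(mvar v :: 'a mpoly) ^ n = Poly_Mapping.single (Poly_Mapping.single v n) 1" for n
    by (induction n) (simp_all add: mvar_def mult_single flip: single_add)
  have "mon_power mvar (Poly_Mapping.single v n) = (mvar v :: 'a mpoly) ^ n"
    by (simp add: mon_power_def)
  then have "mconst c * mon_power mvar (t + Poly_Mapping.single v n) =
      Poly_Mapping.single t c * Poly_Mapping.single (Poly_Mapping.single v n) 1"
    by (simp add: mon_power_add pow mult.assoc[symmetric] flip: add)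
  then show ?case by (simp add: mult_single)
qed (simp add: mconst_def)

context jordan_data
begin

text \<open>\<open>Lin 0\<close> is not a generator; it serves as the label of \<open>a\<^bsub>1,1\<^esub>\<close>, the one variable that the
  generators do not recover from the \<open>a\<^bsub>0,i\<^esub>\<close>.\<close>

definition form :: "gen \<Rightarrow> 'a mpoly" where
  "form x = (if x = Lin 0 then avar ns 1 1 else gen_form ns x)"

definition labels :: "gen set" where
  "labels = insert (Lin 0) (gens k l ns)"

lemma Lin_0_notin_gens: "Lin 0 \<notin> gens k l ns"
  by (auto simp: gens_def)

lemma form_gen: "x \<in> gens k l ns \<Longrightarrow> form x = gen_form ns x"
  using Lin_0_notin_gens by (auto simp: form_def)

lemma Lin_in_gens: "1 \<le> i \<Longrightarrow> i \<le> k \<Longrightarrow> Lin i \<in> gens k l ns"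
  by (simp add: gens_def)

sublocale form: mon_eval mconst "\<lambda>I. \<Prod>x\<in>#I. form x"
  by (rule mon_eval_mset[OF comm_ring_hom_mconst])

definition dprod :: "(nat \<Rightarrow> nat) \<Rightarrow> 'a mpoly" where
  "dprod m = (\<Prod>i = 1..l. avar ns 0 i ^ m i)"

lemma lsubst_denom: "lsubst mconst form (denom l m) = dprod m"
  unfolding denom_eq dprod_def form.ext.hom_prod form.ext.hom_power
  by (intro prod.cong) (auto simp: comm_ring_hom_mconst form_def)

lemma dprod_add: "dprod (\<lambda>i. m i + m' i) = dprod m * dprod m'"
  unfolding lsubst_denom[symmetric] denom_mult[symmetric] form.ext.hom_mult ..

lemma denom_labelled: "denom l m \<in> labelled labels"
  unfolding denom_eq using l_le_k
  by (intro subring_set_prod[OF subring_set_labelled] subring_set_power[OF subring_set_labelled] labelled_single)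
    (auto simp: labels_def Lin_in_gens)

text \<open>Polynomials that become expressible by the forms once the \<open>a_{0,i}\<close> with
  \<open>i <= l\<close> are inverted. The rule \<open>cancel\<close> encodes the inversion without
  leaving the polynomial ring.\<close>

inductive_set localized :: "'a mpoly set" where
  const: "mconst c \<in> localized"
| form: "x \<in> labels \<Longrightarrow> form x \<in> localized"
| add: "p \<in> localized \<Longrightarrow> q \<in> localized \<Longrightarrow> p + q \<in> localized"
| mult: "p \<in> localized \<Longrightarrow> q \<in> localized \<Longrightarrow> p * q \<in> localized"
| cancel: "p * avar ns 0 i \<in> localized \<Longrightarrow> 1 \<le> i \<Longrightarrow> i \<le> l \<Longrightarrow> p \<in> localized"

text \<open>Sums are brought to a common denominator, which the numerators can absorb because the
  \<open>a_{0,i}\<close> carry labels themselves. Undoing a multiplication by \<open>a_{0,i}\<close>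
  raises the exponent \<open>m i\<close> by 1.\<close>

lemma localized_imp_fraction:
  "p \<in> localized \<Longrightarrow> \<exists>m F. F \<in> labelled labels \<and> p * dprod m = lsubst mconst form F"
proof (induction rule: localized.induct)
  case (const c)
  show ?case
    by (rule exI[of _ "\<lambda>_. 0"], rule exI[of _ "Poly_Mapping.single 0 c"])
      (simp add: labelled_single dprod_def)
next
  case (form x)
  then show ?case
    by (intro exI[of _ "\<lambda>_. 0"] exI[of _ "lab x"])
      (simp add: labelled_single dprod_def)
next
  case (add p q)
  then obtain m F m' F' where F: "F \<in> labelled labels" "p * dprod m = lsubst mconst form F"
    "F' \<in> labelled labels" "q * dprod m' = lsubst mconst form F'" by blast
  then have "(p + q) * dprod (\<lambda>i. m i + m' i) = lsubst mconst form (F * denom l m' + F' * denom l m)"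
    unfolding form.ext.hom_add form.ext.hom_mult lsubst_denom dprod_add F(2)[symmetric] F(4)[symmetric]
    by (simp add: algebra_simps)
  moreover have "F * denom l m' + F' * denom l m \<in> labelled labels"
    by (intro subring_setD[OF subring_set_labelled] denom_labelled F)
  ultimately show ?case by blast
next
  case (mult p q)
  then obtain m F m' F' where F: "F \<in> labelled labels" "p * dprod m = lsubst mconst form F"
    "F' \<in> labelled labels" "q * dprod m' = lsubst mconst form F'" by blast
  then have "(p * q) * dprod (\<lambda>i. m i + m' i) = lsubst mconst form (F * F')"
    unfolding form.ext.hom_mult dprod_add F(2)[symmetric] F(4)[symmetric]
    by (simp add: algebra_simps)
  moreover have "F * F' \<in> labelled labels"
    using F by (simp add: subring_setD[OF subring_set_labelled])
  ultimately show ?case by blast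
next
  case (cancel p i)
  then obtain m F where F: "F \<in> labelled labels" "p * avar ns 0 i * dprod m = lsubst mconst form F"
    by blast
  have "dprod (\<lambda>j. if j = i then 1 else 0) = avar ns 0 i"
    using cancel unfolding dprod_def by (simp add: if_distrib[of "\<lambda>n. _ ^ n"] prod.delta cong: if_cong)
  then have "p * dprod (\<lambda>j. (if j = i then 1 else 0) + m j) = lsubst mconst form F"
    unfolding dprod_add F(2)[symmetric] by (simp add: mult.assoc)
  with F(1) show ?case by blast
qed

lemma subring_set_localized: "subring_set localized"
proof -
  have "- p \<in> localized" if "p \<in> localized" for p
    using localized.mult[OF localized.const[of "-1"] that] by (simp add: mconst.hom_uminus)
  then show ?thesis
    using localized.const[of 0] localized.const[of 1]
    unfolding subring_set_def by (auto intro: localized.add localized.mult)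
qed

lemma cancel_power: "p * avar ns 0 i ^ n \<in> localized \<Longrightarrow> 1 \<le> i \<Longrightarrow> i \<le> l \<Longrightarrow> p \<in> localized"
proof (induction n)
  case (Suc n)
  then have "p * avar ns 0 i ^ n * avar ns 0 i \<in> localized" by (simp add: mult_ac)
  from localized.cancel[OF this] Suc show ?case by simp
qed simp

text \<open>The triangular system is solved: \<open>a_{0,i}\<close> is a form,
  \<open>a_{1,1}\<close> has the label \<open>Lin 0\<close>, \<open>a_{1,i+1}\<close> comes from
  \<open>Mix i\<close>, and \<open>a_{s,i}\<close> with \<open>s >= 2\<close> from
  \<open>Blk i s\<close> and the earlier variables of its block.\<close>

lemma avar_localized:
  assumes "1 \<le> i" "i \<le> k" "s < ns i"
  shows "avar ns s i \<in> localized"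
proof -
  note R = subring_setD[OF subring_set_localized]
  have gen: "gen_form ns x \<in> localized" if "x \<in> gens k l ns" for x
    using localized.form[of x] form_gen[OF that] that by (simp add: labels_def)
  have zero: "avar ns 0 j \<in> localized" if "1 \<le> j" "j \<le> k" for j
    using gen[of "Lin j"] Lin_in_gens[of j] that by simp
  have one: "avar ns 1 (Suc j) \<in> localized" if "Suc j \<le> l" for j
    using that
  proof (induction j)
    case 0
    show ?case using localized.form[of "Lin 0"] by (simp add: labels_def form_def)
  next
    case (Suc j)
    have "Mix (Suc j) \<in> gens k l ns" using Suc.prems by (simp add: gens_def)
    \<comment> \<open>Adding the product already known to be in \<open>localized\<close> leaves
      \<open>a_{0,i} a_{1,i+1}\<close> with \<open>i = Suc j\<close>, from which
      \<open>a_{0,i}\<close> cancels.\<close>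
    from gen[OF this] have "gen_form ns (Mix (Suc j)) + avar ns 1 (Suc j) * avar ns 0 (Suc (Suc j)) \<in> localized"
      using Suc l_le_k by (intro R zero) auto
    then have "avar ns 1 (Suc (Suc j)) * avar ns 0 (Suc j) \<in> localized"
      by (simp add: mult.commute)
    from localized.cancel[OF this] Suc.prems show ?case by simp
  qed
  show ?thesis using \<open>s < ns i\<close>
  proof (induction s rule: less_induct)
    case (less s)
    consider "s = 0" | "s = 1" | "2 \<le> s" by linarith
    then show ?case
    proof cases
      case 1
      with zero assms show ?thesis by simp
    next
      case 2
      with less have "i \<le> l" using ns_eq_1[of i] assms by (cases "i \<le> l") auto
      with 2 one[of "i - 1"] assms show ?thesis by simp
    next
      case 3
      with less have il: "i \<le> l" using ns_eq_1[of i] assms by (cases "i \<le> l") auto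
      let ?a = "\<lambda>s. avar ns s i :: 'a mpoly"
      have "Blk i s \<in> gens k l ns" using less 3 assms by (auto simp: gens_def)
      from gen[OF this] have "P_form ?a s \<in> localized" by simp
      moreover have "P_form (?a(s := 0)) s \<in> localized"
        using less 3 by (intro subring_set_P_form[OF subring_set_localized]) (auto intro: R)
      ultimately have "P_form ?a s - P_form (?a(s := 0)) s \<in> localized" by (rule R)
      also have "P_form ?a s - P_form (?a(s := 0)) s =
          of_int (P_lead s) * ?a 0 ^ (if even s then 1 else 2) * ?a s"
        using P_form_split[OF 3, of ?a] by simp
      \<comment> \<open>In characteristic zero the integer \<open>P_lead s\<close> is invertible;
        the remaining power of \<open>a_{0,i}\<close> is cancelled afterwards.\<close>
      finally have "mconst (1 / of_int (P_lead s)) * (of_int (P_lead s) * ?a 0 ^ (if even s then 1 else 2) * ?a s) \<in> localized"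
        by (rule localized.mult[OF localized.const])
      also have "mconst (1 / of_int (P_lead s)) * (of_int (P_lead s) * ?a 0 ^ (if even s then 1 else 2) * ?a s) =
        mconst (1 / of_int (P_lead s) * of_int (P_lead s)) * (?a s * ?a 0 ^ (if even s then 1 else 2))"
        unfolding mconst.hom_mult mconst.hom_of_int by (simp only: mult_ac)
      also have "\<dots> = ?a s * ?a 0 ^ (if even s then 1 else 2)"
        using P_lead_nonzero[OF 3] by simp
      finally show ?thesis by (rule cancel_power) (use assms il in auto)
    qed
  qed
qed

lemma poly_in_localized:
  assumes "poly_in (offset ns (Suc k)) p"
  shows "p \<in> localized"
proof -
  have "mvar v \<in> localized" if v: "v < offset ns (Suc k)" for v
  proof -
    obtain i s where "1 \<le> i" "i \<le> k" "s < ns i" "v = offset ns i + s"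
      using v by (rule offset_cases)
    then show ?thesis using avar_localized by (simp add: avar_eq)
  qed
  then have "(\<Sum>t\<in>Poly_Mapping.keys p. mconst (Poly_Mapping.lookup p t) * mon_power mvar t) \<in> localized"
    using assms unfolding mon_power_def poly_in_def
    by (intro subring_set_sum[OF subring_set_localized] localized.mult localized.const
        subring_set_prod[OF subring_set_localized] subring_set_power[OF subring_set_localized]) blast
  then show ?thesis
    using poly_mapping_sum_single[of p] by (simp add: single_eq_mon_power)
qed

end

subsection \<open>Algebraic independence\<close>

text \<open>Lets the labels be injected into the variable indices, so that they can serve as
  independent variables of \<open>mpoly\<close>.\<close>

instance gen :: countable
  by countable_datatype

text \<open>\<open>P_r\<close> is linear in \<open>b r\<close> with nonzero coefficient and does not
  involve later entries, so the entries from index 2 on can be chosen one after the other.\<close>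

lemma P_form_solve:
  fixes c0 c1 :: "'b::field" and y :: "nat \<Rightarrow> 'b"
  assumes c0: "c0 \<noteq> 0" and lead: "\<And>r. 2 \<le> r \<Longrightarrow> of_int (P_lead r) \<noteq> (0 :: 'b)"
  shows "\<exists>b. b 0 = c0 \<and> b 1 = c1 \<and> (\<forall>r. 2 \<le> r \<and> r \<le> n \<longrightarrow> P_form b r = y r)"
proof (induction n)
  case 0
  show ?case by (rule exI[of _ "\<lambda>s. if s = 0 then c0 else c1"]) simp
next
  case (Suc n)
  then obtain b where b: "b 0 = c0" "b 1 = c1" "\<And>r. 2 \<le> r \<Longrightarrow> r \<le> n \<Longrightarrow> P_form b r = y r"
    by blast
  show ?case
  proof (cases "2 \<le> Suc n")
    case False
    with b show ?thesis by auto
  next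
    case True
    let ?e = "if even (Suc n) then 1 else 2 :: nat"
    define z where "z = (y (Suc n) - P_form (b(Suc n := 0)) (Suc n)) / (of_int (P_lead (Suc n)) * c0 ^ ?e)"
    define b' where "b' = b(Suc n := z)"
    have "P_form b' (Suc n) = P_form (b'(Suc n := 0)) (Suc n) + of_int (P_lead (Suc n)) * b' 0 ^ ?e * b' (Suc n)"
      by (rule P_form_split[OF True])
    moreover have "b'(Suc n := 0) = b(Suc n := 0)" "b' 0 = c0" "b' (Suc n) = z"
      using True b by (auto simp: b'_def)
    moreover have "of_int (P_lead (Suc n)) * c0 ^ ?e \<noteq> 0"
      using c0 lead[OF True] by simp
    ultimately have "P_form b' (Suc n) = y (Suc n)"
      by (simp add: z_def)
    moreover have "P_form b' r = y r" if "2 \<le> r" "r \<le> n" for r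
    proof -
      have "P_form b' r = P_form b r" using that by (intro P_form_cong) (auto simp: b'_def)
      with b that show ?thesis by simp
    qed
    ultimately have "\<forall>r. 2 \<le> r \<and> r \<le> Suc n \<longrightarrow> P_form b' r = y r" by (auto simp: le_Suc_eq)
    moreover have "b' 0 = c0" "b' 1 = c1" using True b by (auto simp: b'_def)
    ultimately show ?thesis by blast
  qed
qed

lemma comm_ring_hom_to_fract: "comm_ring_hom (to_fract :: 'b::idom \<Rightarrow> 'b fract)"
  by unfold_locales simp_all

text \<open>Distinct multisets of labels become distinct monomials, so renaming labels as variables
  is injective.\<close>

lemma lsubst_mvar_eq_0D:
  fixes F :: "'x multiset \<Rightarrow>\<^sub>0 'a::comm_ring_1"
  assumes "inj e" "lsubst mconst (\<lambda>x. mvar (e x)) F = 0"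
  shows "F = 0"
proof (rule poly_mapping_eqI)
  fix J
  define mon :: "'x multiset \<Rightarrow> nat \<Rightarrow>\<^sub>0 nat" where "mon I = (\<Sum>x\<in>#I. Poly_Mapping.single (e x) 1)" for I
  have lookup_mon: "Poly_Mapping.lookup (mon I) (e x) = count I x" for I x
    by (induction I) (auto simp: mon_def lookup_add lookup_single when_def injD[OF assms(1)])
  have inj: "mon I = mon J \<longleftrightarrow> I = J" for I J
    by (metis lookup_mon multiset_eqI)
  have prod: "(\<Prod>x\<in>#I. mvar (e x)) = Poly_Mapping.single (mon I) (1::'a)" for I
    by (induction I) (simp_all add: mon_def mvar_def mult_single)
  have "lsubst mconst (\<lambda>x. mvar (e x)) F =
      (\<Sum>I\<in>Poly_Mapping.keys F. Poly_Mapping.single (mon I) (Poly_Mapping.lookup F I))"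
    by (simp add: mext_def prod mconst_def mult_single)
  with assms(2) have "0 = Poly_Mapping.lookup (\<Sum>I\<in>Poly_Mapping.keys F. Poly_Mapping.single (mon I) (Poly_Mapping.lookup F I)) (mon J)"
    by simp
  also have "\<dots> = Poly_Mapping.lookup F J"
    by (simp add: lookup_sum lookup_single inj when_def sum.delta' in_keys_iff)
  finally show "Poly_Mapping.lookup F J = Poly_Mapping.lookup 0 J" by simp
qed

context jordan_data
begin

text \<open>The triangular system is solvable over any field in which the leading coefficients and
  the \<open>X (Lin i)\<close> do not vanish. It is used with independent variables as prescribed
  values.\<close>

lemma generic_point:
  fixes X :: "gen \<Rightarrow> 'b::field"
  assumes X: "\<And>i. X (Lin i) \<noteq> 0" and lead: "\<And>r. 2 \<le> r \<Longrightarrow> of_int (P_lead r) \<noteq> (0 :: 'b)"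
  shows "\<exists>b. (\<forall>i. b i 0 = X (Lin i)) \<and> b 1 1 = X (Lin 0) \<and>
    (\<forall>i r. 2 \<le> r \<and> r \<le> ns i \<longrightarrow> P_form (b i) r = X (Blk i r)) \<and>
    (\<forall>i\<ge>1. b i 0 * b (Suc i) 1 - b i 1 * b (Suc i) 0 = X (Mix i))"
proof -
  \<comment> \<open>\<open>w i\<close> is the intended value of \<open>b (Suc i) 1\<close>: it
    starts from the value of \<open>Lin 0\<close> in block 1 and solves the equation of each
    \<open>Mix\<close> for the next block.\<close>
  define w where "w = rec_nat (X (Lin 0))
    (\<lambda>i z. (X (Mix (Suc i)) + z * X (Lin (Suc (Suc i)))) / X (Lin (Suc i)))"
  have "\<exists>b. b 0 = X (Lin i) \<and> b 1 = w (i - 1) \<and> (\<forall>r. 2 \<le> r \<and> r \<le> ns i \<longrightarrow> P_form b r = X (Blk i r))" for i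
    by (rule P_form_solve) (use X lead in auto)
  then obtain b where b: "\<And>i. b i 0 = X (Lin i)" "\<And>i. b i 1 = w (i - 1)"
    "\<And>i r. 2 \<le> r \<and> r \<le> ns i \<longrightarrow> P_form (b i) r = X (Blk i r)"
    by metis
  have "b i 0 * b (Suc i) 1 - b i 1 * b (Suc i) 0 = X (Mix i)" if i: "1 \<le> i" for i
  proof -
    obtain j where "i = Suc j" using i by (cases i) auto
    then show ?thesis using X[of "Suc j"] unfolding b(1,2) by (simp add: w_def)
  qed
  moreover have "b 1 1 = X (Lin 0)" unfolding b(2) by (simp add: w_def)
  ultimately show ?thesis using b by blast
qed

text \<open>At a point where the forms take independent variables as values, a relation between the
  forms becomes a relation between these variables.\<close>

lemma labels_independent:
  assumes F: "F \<in> labelled labels" and zero: "lsubst mconst form F = 0"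
  shows "F = 0"
proof -
  interpret fr: comm_ring_hom "to_fract :: 'a mpoly \<Rightarrow> 'a mpoly fract"
    by (rule comm_ring_hom_to_fract)
  \<comment> \<open>The values lie in a fraction field because solving for the point divides by the
    \<open>X (Lin i)\<close>.\<close>
  define X where "X x = to_fract (mvar (to_nat x) :: 'a mpoly)" for x :: gen
  have "X (Lin i) \<noteq> 0" for i
  proof -
    have "Poly_Mapping.lookup (mvar (to_nat (Lin i)) :: 'a mpoly) (Poly_Mapping.single (to_nat (Lin i)) 1) \<noteq> 0"
      by (simp add: mvar_def)
    then show ?thesis by (auto simp: X_def simp del: One_nat_def)
  qed
  moreover have "of_int (P_lead r) \<noteq> (0 :: 'a mpoly fract)" if "2 \<le> r" for r
    using P_lead_nonzero[OF that] fr.hom_of_int[of "P_lead r"] to_fract_eq_0_iff[of "of_int (P_lead r) :: 'a mpoly"]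
    by simp
  ultimately have "\<exists>b. (\<forall>i. b i 0 = X (Lin i)) \<and> b 1 1 = X (Lin 0) \<and>
    (\<forall>i r. 2 \<le> r \<and> r \<le> ns i \<longrightarrow> P_form (b i) r = X (Blk i r)) \<and>
    (\<forall>i\<ge>1. b i 0 * b (Suc i) 1 - b i 1 * b (Suc i) 0 = X (Mix i))"
    by (intro generic_point)
  then obtain b where b: "\<forall>i. b i 0 = X (Lin i)" "b 1 1 = X (Lin 0)"
    "\<forall>i r. 2 \<le> r \<and> r \<le> ns i \<longrightarrow> P_form (b i) r = X (Blk i r)"
    "\<forall>i\<ge>1. b i 0 * b (Suc i) 1 - b i 1 * b (Suc i) 0 = X (Mix i)"
    by (elim exE conjE)
  let ?D = "{(i, s). 1 \<le> i \<and> s < ns i}"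
  \<comment> \<open>The point \<open>b\<close> is indexed by block and position; \<open>pt\<close>
    reindexes it by variable number.\<close>
  define pt where "pt v = (case inv_into ?D (\<lambda>(i, s). offset ns i + s) v of (i, s) \<Rightarrow> b i s)" for v
  have "inj_on (\<lambda>(i, s). offset ns i + s) ?D"
  proof (rule inj_onI)
    fix x y assume "x \<in> ?D" "y \<in> ?D" "(\<lambda>(i, s). offset ns i + s) x = (\<lambda>(i, s). offset ns i + s) y"
    then show "x = y"
      using offset_inj[of "fst x" "fst y" "snd x" ns "snd y"] by (auto simp: case_prod_beta prod_eq_iff)
  qed
  then have pt: "pt (offset ns i + s) = b i s" if "1 \<le> i" "s < ns i" for i s
    using inv_into_f_f[of "\<lambda>(i, s). offset ns i + s" ?D "(i, s)"] that by (simp add: pt_def)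
  define \<iota> where "\<iota> c = to_fract (mconst c :: 'a mpoly)" for c
  have \<iota>: "comm_ring_hom \<iota>"
    by unfold_locales (simp_all add: \<iota>_def mconst.hom_add mconst.hom_mult)
  interpret ev: mon_eval \<iota> "mon_power pt"
    by (rule mon_eval_mon_power[OF \<iota>])
  define E where "E = mext \<iota> (mon_power pt)"
  interpret E: comm_ring_hom E
    unfolding E_def by (rule ev.ext.comm_ring_hom_axioms)
  have E_avar: "E (avar ns s i) = b i s" if "1 \<le> i" "s < ns i" for i s
    using pt[OF that] by (simp add: E_def avar_eq mvar_def mon_power_single \<iota>_def del: One_nat_def)
  have E_mconst: "E (mconst c) = \<iota> c" for c
    by (simp add: E_def mconst_def)
  have E_form: "E (form x) = X x" if "x \<in> labels" for x
  proof (cases "x = Lin 0")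
    case True
    then show ?thesis using b(2) ns_ge_2[of 1] l_pos by (simp add: form_def E_avar)
  next
    case False
    with that have "x \<in> gens k l ns" by (simp add: labels_def)
    then show ?thesis
    proof (cases rule: gens_cases)
      case (Lin i)
      then show ?thesis using ns_pos b(1) by (simp add: form_def E_avar)
    next
      case (Blk i r)
      have "E (P_form (\<lambda>s. avar ns s i) r) = P_form (b i) r"
        unfolding E.hom_P_form using Blk by (intro P_form_cong) (auto simp: E_avar)
      then show ?thesis using Blk b(3) by (simp add: form_def)
    next
      case (Mix i)
      then have "2 \<le> ns i" "2 \<le> ns (Suc i)" using ns_ge_2 by auto
      then show ?thesis using Mix b(4)
        by (simp add: form_def E_avar E.hom_minus E.hom_mult)
    qed
  qed
  \<comment> \<open>Substituting the variables \<open>X\<close> into \<open>F\<close> factors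
    through substituting the forms, which gives 0.\<close>
  have "lsubst \<iota> X F = lsubst (\<lambda>c. E (mconst c)) (\<lambda>x. E (form x)) F"
    by (rule lsubst_labelled_cong[OF F]) (simp_all add: E_form E_mconst)
  also have "\<dots> = E (lsubst mconst form F)"
    unfolding E.hom_mext E.hom_prod_mset by (simp add: multiset.map_comp comp_def)
  also have "\<dots> = 0" by (simp add: zero)
  also have "lsubst \<iota> X F = to_fract (lsubst mconst (\<lambda>x. mvar (to_nat x)) F)"
    unfolding fr.hom_mext fr.hom_prod_mset by (simp add: multiset.map_comp comp_def X_def \<iota>_def[abs_def])
  finally have "lsubst mconst (\<lambda>x. mvar (to_nat x)) F = 0" by simp
  then show ?thesis by (rule lsubst_mvar_eq_0D[OF inj_to_nat])
qed

end

subsection \<open>Comparison of coefficients\<close>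

lemma lookup_single_0_times:
  "Poly_Mapping.lookup (Poly_Mapping.single 0 c * F) I = c * Poly_Mapping.lookup F I"
  for F :: "'m::comm_monoid_add \<Rightarrow>\<^sub>0 'a::comm_ring_1"
proof (induction F rule: poly_mapping_induct)
  case (add t d F)
  then show ?case
    by (simp add: distrib_left lookup_add mult_single lookup_single when_def)
qed simp

section \<open>The action of \<open>A\<close> on formal polynomials\<close>

text \<open>With \<open>T\<close> standing for \<open>a_{1,1}\<close> and \<open>Y\<close> for
  \<open>a_{0,1}\<close>, this is the action of \<open>A\<close> in the triangular coordinates:
  \<open>T\<close> goes to a multiple of \<open>T + Y\<close>, every other label is scaled.\<close>

definition twist :: "'x \<Rightarrow> 'x \<Rightarrow> ('x \<Rightarrow> 'a) \<Rightarrow> 'x \<Rightarrow> 'x multiset \<Rightarrow>\<^sub>0 'a::comm_ring_1" where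
  "twist T Y \<mu> x = Poly_Mapping.single 0 (\<mu> x) * (if x = T then lab T + lab Y else lab x)"

text \<open>Only the occurrences of \<open>T\<close> branch, and the binomial theorem expands
  them.\<close>

lemma prod_twist:
  "(\<Prod>x\<in>#I. twist T Y \<mu> x) = (\<Sum>i\<le>count I T. Poly_Mapping.single
      (filter_mset (\<lambda>x. x \<noteq> T) I + replicate_mset i T + replicate_mset (count I T - i) Y)
      ((\<Prod>x\<in>#I. \<mu> x) * of_nat (count I T choose i)))"
proof -
  interpret s0: comm_ring_hom "Poly_Mapping.single 0 :: 'b \<Rightarrow> 'a multiset \<Rightarrow>\<^sub>0 'b"
    by (rule comm_ring_hom_single_0)
  let ?J = "filter_mset (\<lambda>x. x \<noteq> T) I"
  have *: "Poly_Mapping.single 0 w * (Poly_Mapping.single ?J 1 * (of_nat n * lab T ^ i * lab Y ^ j)) =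
      Poly_Mapping.single (?J + replicate_mset i T + replicate_mset j Y) (w * of_nat n)" for w :: 'b and n i j
    unfolding single_replicate_mset[symmetric] s0.hom_of_nat[symmetric]
    by (simp add: mult_single add.assoc del: single_of_nat)
  have "(\<Prod>x\<in>#I. twist T Y \<mu> x) = Poly_Mapping.single 0 (\<Prod>x\<in>#I. \<mu> x) *
      (Poly_Mapping.single ?J 1 * (lab T + lab Y) ^ count I T)"
  proof (induction I)
    case (add x I)
    have lab: "Poly_Mapping.single (add_mset x J) (1 :: 'b) = lab x * Poly_Mapping.single J 1" for J
      by (simp add: mult_single)
    show ?case
    proof (cases "x = T")
      case True
      then show ?thesis by (simp add: add twist_def[of T Y \<mu> T] s0.hom_mult mult_ac)
    next
      case False
      then have "filter_mset (\<lambda>x. x \<noteq> T) (add_mset x I) = add_mset x (filter_mset (\<lambda>x. x \<noteq> T) I)"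
        by simp
      with False show ?thesis
        by (simp add: add twist_def[of T Y \<mu> x] s0.hom_mult lab[of "filter_mset _ _"] mult_ac)
    qed
  qed simp
  also have "\<dots> = (\<Sum>i\<le>count I T. Poly_Mapping.single 0 (\<Prod>x\<in>#I. \<mu> x) * (Poly_Mapping.single ?J 1 *
      (of_nat (count I T choose i) * lab T ^ i * lab Y ^ (count I T - i))))"
    unfolding binomial_ring sum_distrib_left ..
  also have "\<dots> = (\<Sum>i\<le>count I T. Poly_Mapping.single
      (?J + replicate_mset i T + replicate_mset (count I T - i) Y) ((\<Prod>x\<in>#I. \<mu> x) * of_nat (count I T choose i)))"
    unfolding * ..
  finally show ?thesis .
qed

text \<open>A multiset is determined by its \<open>T\<close>-count and its \<open>T\<close>-free
  part, and \<open>Y\<close> differs from \<open>T\<close>. So each \<open>I\<close> contributes to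
  \<open>K\<close> through at most the one binomial term \<open>i = count K T\<close>.\<close>

lemma lookup_lsubst_twist:
  assumes "T \<noteq> Y"
  shows "Poly_Mapping.lookup (lsubst (Poly_Mapping.single 0) (twist T Y \<mu>) F) K =
    (\<Sum>I\<in>Poly_Mapping.keys F. if count K T \<le> count I T \<and>
         filter_mset (\<lambda>x. x \<noteq> T) I + replicate_mset (count I T - count K T) Y = filter_mset (\<lambda>x. x \<noteq> T) K
       then Poly_Mapping.lookup F I * (\<Prod>x\<in>#I. \<mu> x) * of_nat (count I T choose count K T) else 0)"
  unfolding mext_def lookup_sum
proof (intro sum.cong refl)
  fix I
  let ?J = "filter_mset (\<lambda>x. x \<noteq> T)"
  have split: "K = ?J K + replicate_mset (count K T) T"
    by (rule multiset_eqI) auto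
  have iff: "?J I + replicate_mset i T + replicate_mset (count I T - i) Y = K \<longleftrightarrow>
      i = count K T \<and> ?J I + replicate_mset (count I T - i) Y = ?J K" for i
  proof
    assume K: "?J I + replicate_mset i T + replicate_mset (count I T - i) Y = K"
    show "i = count K T \<and> ?J I + replicate_mset (count I T - i) Y = ?J K"
      using assms unfolding K[symmetric] by (auto simp: multiset_eq_iff)
  next
    assume i: "i = count K T \<and> ?J I + replicate_mset (count I T - i) Y = ?J K"
    have "?J I + replicate_mset i T + replicate_mset (count I T - i) Y =
        ?J I + replicate_mset (count I T - i) Y + replicate_mset i T"
      by (simp add: ac_simps)
    also have "\<dots> = ?J K + replicate_mset (count K T) T" using i by auto
    also have "\<dots> = K" by (rule split[symmetric])
    finally show "?J I + replicate_mset i T + replicate_mset (count I T - i) Y = K" .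
  qed
  show "Poly_Mapping.lookup (Poly_Mapping.single 0 (Poly_Mapping.lookup F I) * (\<Prod>x\<in>#I. twist T Y \<mu> x)) K =
    (if count K T \<le> count I T \<and> ?J I + replicate_mset (count I T - count K T) Y = ?J K
       then Poly_Mapping.lookup F I * (\<Prod>x\<in>#I. \<mu> x) * of_nat (count I T choose count K T) else 0)"
    unfolding lookup_single_0_times prod_twist lookup_sum lookup_single when_def iff
  proof (cases "count K T \<le> count I T \<and> ?J I + replicate_mset (count I T - count K T) Y = ?J K")
    case True
    then have "(i = count K T \<and> ?J I + replicate_mset (count I T - i) Y = ?J K) = (i = count K T)" for i
      by auto
    with True show "Poly_Mapping.lookup F I * (\<Sum>i\<le>count I T.
          if i = count K T \<and> ?J I + replicate_mset (count I T - i) Y = ?J K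
          then (\<Prod>x\<in>#I. \<mu> x) * of_nat (count I T choose i) else 0) =
        (if count K T \<le> count I T \<and> ?J I + replicate_mset (count I T - count K T) Y = ?J K
         then Poly_Mapping.lookup F I * (\<Prod>x\<in>#I. \<mu> x) * of_nat (count I T choose count K T) else 0)"
      by (simp add: sum.delta mult.assoc)
  next
    case False
    then show "Poly_Mapping.lookup F I * (\<Sum>i\<le>count I T.
          if i = count K T \<and> ?J I + replicate_mset (count I T - i) Y = ?J K
          then (\<Prod>x\<in>#I. \<mu> x) * of_nat (count I T choose i) else 0) =
        (if count K T \<le> count I T \<and> ?J I + replicate_mset (count I T - count K T) Y = ?J K
         then Poly_Mapping.lookup F I * (\<Prod>x\<in>#I. \<mu> x) * of_nat (count I T choose count K T) else 0)"
      by (subst sum.neutral) auto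
  qed
qed

text \<open>In top \<open>T\<close>-degree \<open>d\<close> the twist only multiplies a monomial \<open>N\<close> by its weight, which is thus
  \<open>\<kappa>\<close>.  If \<open>d > 0\<close>, the monomial \<open>N Y / T\<close> has the same weight, so its coefficient is multiplied by
  \<open>\<kappa>\<close> too, but it receives in addition \<open>d \<kappa>\<close> times the coefficient of \<open>N\<close>.\<close>

lemma twist_eigenvector:
  fixes F :: "'x multiset \<Rightarrow>\<^sub>0 'a::field_char_0"
  assumes TY: "T \<noteq> Y" "\<mu> T = \<mu> Y"
    and \<mu>: "\<And>I x. I \<in> Poly_Mapping.keys F \<Longrightarrow> x \<in># I \<Longrightarrow> \<mu> x \<noteq> 0"
    and eig: "lsubst (Poly_Mapping.single 0) (twist T Y \<mu>) F = Poly_Mapping.single 0 \<kappa> * F"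
    and N: "N \<in> Poly_Mapping.keys F"
  shows "T \<notin># N" "(\<Prod>x\<in>#N. \<mu> x) = \<kappa>"
proof -
  let ?J = "filter_mset (\<lambda>x. x \<noteq> T)"
  let ?w = "\<lambda>I. \<Prod>x\<in>#I. \<mu> x"
  have split: "K = ?J K + replicate_mset (count K T) T" for K
    by (rule multiset_eqI) auto
  have inj: "I = K" if "?J I = ?J K" "count I T = count K T" for I K
    using split[of I] split[of K] that by simp
  have top: "?w K = \<kappa>" if K: "K \<in> Poly_Mapping.keys F"
    and max: "\<And>I. I \<in> Poly_Mapping.keys F \<Longrightarrow> count I T \<le> count K T" for K
  proof -
    have "\<kappa> * Poly_Mapping.lookup F K = (\<Sum>I\<in>Poly_Mapping.keys F. if I = K then Poly_Mapping.lookup F I * ?w I else 0)"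
      unfolding lookup_single_0_times[symmetric] eig[symmetric] lookup_lsubst_twist[OF TY(1)]
    proof (intro sum.cong refl)
      fix I assume I: "I \<in> Poly_Mapping.keys F"
      show "(if count K T \<le> count I T \<and> ?J I + replicate_mset (count I T - count K T) Y = ?J K
          then Poly_Mapping.lookup F I * ?w I * of_nat (count I T choose count K T) else 0) =
        (if I = K then Poly_Mapping.lookup F I * ?w I else 0)"
        using max[OF I] inj[of I K] by auto
    qed
    also have "\<dots> = Poly_Mapping.lookup F K * ?w K" using K by (simp add: sum.delta')
    finally show ?thesis using K by (simp add: in_keys_iff)
  qed
  have no_T: "count I T = 0" if I: "I \<in> Poly_Mapping.keys F" for I
  proof (rule ccontr)
    assume pos: "count I T \<noteq> 0"
    define d where "d = Max ((\<lambda>I. count I T) ` Poly_Mapping.keys F)"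
    have max: "count I T \<le> d" if "I \<in> Poly_Mapping.keys F" for I
      unfolding d_def using that by (intro Max_ge) auto
    have "d \<in> (\<lambda>I. count I T) ` Poly_Mapping.keys F"
      unfolding d_def using I by (intro Max_in) auto
    then obtain K where K: "K \<in> Poly_Mapping.keys F" "count K T = d" by blast
    obtain e where d: "d = Suc e" using max[OF I] pos by (cases d) auto
    have wK: "?w K = \<kappa>" using K max by (intro top) auto
    define L where "L = K - {#T#}"
    have KL: "K = add_mset T L" using K(2) d by (simp add: L_def count_greater_zero_iff[symmetric])
    define M where "M = add_mset Y L"
    have M: "count M T = e" "?J M = add_mset Y (?J K)" "?w M = \<kappa>"
      using K(2) d wK TY by (simp_all add: M_def KL)
    have "\<kappa> * Poly_Mapping.lookup F M = (\<Sum>I\<in>Poly_Mapping.keys F.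
        (if I = M then Poly_Mapping.lookup F I * ?w I else 0) +
        (if I = K then Poly_Mapping.lookup F I * ?w I * of_nat d else 0))"
      unfolding lookup_single_0_times[symmetric] eig[symmetric] lookup_lsubst_twist[OF TY(1)]
    proof (intro sum.cong refl)
      fix I assume "I \<in> Poly_Mapping.keys F"
      then have "count I T \<le> d" by (rule max)
      \<comment> \<open>In degree \<open>e\<close> only \<open>M\<close> itself contributes, in
        degree \<open>d\<close> only \<open>K\<close>, with the factor
        \<open>d choose e = d\<close>.\<close>
      then consider "count I T < e" | "count I T = e" | "count I T = d" using d by linarith
      then show "(if count M T \<le> count I T \<and> ?J I + replicate_mset (count I T - count M T) Y = ?J M
          then Poly_Mapping.lookup F I * ?w I * of_nat (count I T choose count M T) else 0) =
        (if I = M then Poly_Mapping.lookup F I * ?w I else 0) +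
        (if I = K then Poly_Mapping.lookup F I * ?w I * of_nat d else 0)"
      proof cases
        case 1
        then show ?thesis using M(1) K(2) d by auto
      next
        case 2
        then show ?thesis using M(1) K(2) d inj[of I M] by auto
      next
        case 3
        then show ?thesis using M(1,2) K(2) d inj[of I K] by auto
      qed
    qed
    also have "\<dots> = Poly_Mapping.lookup F M * \<kappa> + Poly_Mapping.lookup F K * \<kappa> * of_nat d"
      using K(1) M(3) wK by (simp add: sum.distrib sum.delta' in_keys_iff)
    \<comment> \<open>The coefficient of \<open>M\<close>, which may be 0, cancels from both
      sides.\<close>
    finally have "Poly_Mapping.lookup F K * \<kappa> * of_nat d = 0" by (simp add: mult.commute)
    moreover have "?w K \<noteq> 0"
      using \<mu>[OF K(1)] by (auto simp: prod_mset_zero_iff)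
    ultimately show False using K(1) d wK by (simp add: in_keys_iff del: of_nat_Suc)
  qed
  show "T \<notin># N" using no_T[OF N] by (simp add: count_eq_zero_iff)
  show "?w N = \<kappa>" using N no_T by (intro top) auto
qed

section \<open>Existence and uniqueness of the expression\<close>

context jordan_data
begin

text \<open>\<open>Lin 0\<close> gets the eigenvalue of block 1, hence the same weight as
  \<open>Lin 1\<close>, as \<open>twist_eigenvector\<close> requires.\<close>

definition weight :: "gen \<Rightarrow> 'a" where
  "weight x = (if x = Lin 0 then lam 1 else gen_mult lam x)"

lemma weight_gen: "x \<in> gens k l ns \<Longrightarrow> weight x = gen_mult lam x"
  using Lin_0_notin_gens by (auto simp: weight_def)

lemma weight_nonzero:
  assumes "x \<in> labels"
  shows "weight x \<noteq> 0"
proof (cases "x = Lin 0")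
  case True
  then show ?thesis using lam_nonzero[of 1] l_pos l_le_k by (simp add: weight_def)
next
  case False
  with assms have x: "x \<in> gens k l ns" by (simp add: labels_def)
  then show ?thesis
  proof (cases rule: gens_cases)
    case (Mix i)
    then show ?thesis using lam_nonzero[of i] lam_nonzero[of "i + 1"] l_le_k
      by (simp add: weight_def)
  qed (use lam_nonzero in \<open>auto simp: weight_def\<close>)
qed

lemma twist_labelled:
  assumes "F \<in> labelled labels"
  shows "lsubst (Poly_Mapping.single 0) (twist (Lin 0) (Lin 1) weight) F \<in> labelled labels"
proof -
  note R = subring_set_labelled[of labels, where 'a = 'a]
  have "Lin 1 \<in> labels" using l_pos l_le_k by (simp add: labels_def gens_def)
  then have tw: "twist (Lin 0) (Lin 1) weight x \<in> labelled labels" if "x \<in> labels" for x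
    unfolding twist_def using that by (auto intro!: subring_setD[OF R] labelled_single)
  have "set_mset I \<subseteq> labels" if "I \<in> Poly_Mapping.keys F" for I
    using assms that by (simp add: labelled_def)
  then have "(\<Prod>x\<in>#I. twist (Lin 0) (Lin 1) weight x) \<in> labelled labels" if "I \<in> Poly_Mapping.keys F" for I
    using that by (intro subring_set_prod_mset[OF R] tw) blast
  then show ?thesis
    unfolding mext_def by (intro subring_set_sum[OF R] subring_setD(5)[OF R] labelled_single) simp_all
qed

text \<open>Both sides respect the ring operations, so comparing them on labels suffices: on
  \<open>Lin 0\<close> this is the action on \<open>a_{1,1}\<close>, on the generators their
  semi-invariance.\<close>

lemma lsubst_twist:
  assumes "F \<in> labelled labels"
  shows "lsubst mconst form (lsubst (Poly_Mapping.single 0) (twist (Lin 0) (Lin 1) weight) F) =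
    msubst (mat_act A) (lsubst mconst form F)"
proof -
  have twist: "lsubst mconst form (twist (Lin 0) (Lin 1) weight x) = msubst (mat_act A) (form x)"
    if "x \<in> labels" for x
  proof (cases "x = Lin 0")
    case True
    have "msubst (mat_act A) (avar ns 1 1) = mconst (lam 1) * (avar ns 1 1 + avar ns 0 1)"
      using msubst_avar[of 1 1] ns_ge_2[of 1] l_pos l_le_k by simp
    moreover have "form (Lin 0) = avar ns 1 1" "form (Lin 1) = avar ns 0 1"
      by (simp_all add: form_def)
    ultimately show ?thesis
      by (simp add: True twist_def weight_def form.ext.hom_mult form.ext.hom_add comm_ring_hom_mconst)
  next
    case False
    with that have "x \<in> gens k l ns" by (simp add: labels_def)
    then show ?thesis
      using False by (simp add: twist_def form_gen weight_gen msubst_gen_form form.ext.hom_mult comm_ring_hom_mconst)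
  qed
  have "lsubst mconst form (lsubst (Poly_Mapping.single 0) (twist (Lin 0) (Lin 1) weight) F) =
      lsubst (\<lambda>c. lsubst mconst form (Poly_Mapping.single 0 c))
        (\<lambda>x. lsubst mconst form (twist (Lin 0) (Lin 1) weight x)) F"
    unfolding form.ext.hom_mext form.ext.hom_prod_mset by (simp add: multiset.map_comp comp_def)
  also have "\<dots> = lsubst (\<lambda>c. msubst (mat_act A) (mconst c)) (\<lambda>x. msubst (mat_act A) (form x)) F"
    by (rule lsubst_labelled_cong[OF assms]) (simp_all add: twist del: One_nat_def)
  also have "\<dots> = msubst (mat_act A) (lsubst mconst form F)"
    unfolding msubst.hom_mext msubst.hom_prod_mset by (simp add: multiset.map_comp comp_def)
  finally show ?thesis .
qed

lemma msubst_dprod: "msubst (mat_act A) (dprod m) = mconst (\<Prod>i = 1..l. lam i ^ m i) * dprod m"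
proof -
  have "msubst (mat_act A) (avar ns 0 i) = mconst (lam i) * avar ns 0 i" if "i \<in> {1..l}" for i
    using that msubst_gen_form[of "Lin i"] Lin_in_gens[of i] l_le_k by simp
  then show ?thesis
    unfolding dprod_def msubst.hom_prod msubst.hom_power mconst.hom_prod mconst.hom_power prod.distrib[symmetric]
    by (intro prod.cong) (auto simp: power_mult_distrib)
qed

text \<open>The numerator \<open>p * dprod m\<close> is scaled by \<open>A\<close> as well.
  Independence of the labels turns this into an eigenvector equation for \<open>twist\<close>, and
  \<open>twist_eigenvector\<close> then excludes \<open>Lin 0\<close> and fixes the multiplier of
  every term.\<close>

lemma expresses_exists:
  assumes "semi_invariant A \<kappa> p"
  shows "\<exists>m c. expresses k l ns lam \<kappa> m c p"
proof -
  have p: "poly_in (offset ns (Suc k)) p" "msubst (mat_act A) p = mconst \<kappa> * p"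
    using assms by (simp_all add: semi_invariant_def)
  from localized_imp_fraction[OF poly_in_localized[OF p(1)]] obtain m F
    where F: "F \<in> labelled labels" "p * dprod m = lsubst mconst form F" by blast
  \<comment> \<open>The multiplier of the numerator \<open>p * dprod m\<close>.\<close>
  define \<kappa>' where "\<kappa>' = \<kappa> * (\<Prod>i = 1..l. lam i ^ m i)"
  let ?F = "lsubst (Poly_Mapping.single 0) (twist (Lin 0) (Lin 1) weight) F"
  have "lsubst mconst form ?F = mconst \<kappa>' * (p * dprod m)"
    unfolding lsubst_twist[OF F(1)] F(2)[symmetric] msubst.hom_mult p(2) msubst_dprod \<kappa>'_def mconst.hom_mult
    by (simp only: mult_ac)
  also have "\<dots> = lsubst mconst form (Poly_Mapping.single 0 \<kappa>' * F)"
    unfolding form.ext.hom_mult F(2) by simp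
  finally have "lsubst mconst form (?F - Poly_Mapping.single 0 \<kappa>' * F) = 0"
    unfolding form.ext.hom_minus by simp
  moreover have "?F - Poly_Mapping.single 0 \<kappa>' * F \<in> labelled labels"
    by (intro subring_setD(5,6)[OF subring_set_labelled] twist_labelled F labelled_single) simp
  ultimately have "?F - Poly_Mapping.single 0 \<kappa>' * F = 0"
    by (rule labels_independent[rotated])
  then have eig: "?F = Poly_Mapping.single 0 \<kappa>' * F" by simp
  have "weight (Lin 0) = weight (Lin 1)" by (simp add: weight_def)
  moreover have "weight x \<noteq> 0" if "I \<in> Poly_Mapping.keys F" "x \<in># I" for I x
    using F(1) that by (intro weight_nonzero) (auto simp: labelled_def)
  ultimately have keys: "Lin 0 \<notin># I" "(\<Prod>x\<in>#I. weight x) = \<kappa>'" if "I \<in> Poly_Mapping.keys F" for I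
    using twist_eigenvector[of "Lin 0" "Lin 1" weight F \<kappa>' I] eig that by auto
  have gens: "set_mset I \<subseteq> gens k l ns" if "I \<in> Poly_Mapping.keys F" for I
    using F(1) keys(1)[OF that] that by (fastforce simp: labelled_def labels_def)
  have "(\<Prod>x\<in>#I. gen_mult lam x) = \<kappa>'" if "I \<in> Poly_Mapping.keys F" for I
    unfolding keys(2)[OF that, symmetric] using gens[OF that]
    by (intro arg_cong[where f = prod_mset] image_mset_cong) (auto simp: weight_gen)
  moreover have "lsubst mconst form F = lsubst mconst (gen_form ns) F"
    by (rule lsubst_labelled_cong[of F "gens k l ns"]) (use gens in \<open>auto simp: labelled_def form_gen\<close>)
  ultimately have "expresses k l ns lam \<kappa> m F p"
    using gens F(2) by (simp add: expresses_def \<kappa>'_def dprod_def mext_def)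
  then show ?thesis by blast
qed

text \<open>After cross-multiplication both sides have the same image
  \<open>p * dprod m * dprod m'\<close>, so independence of the labels makes them equal.\<close>

lemma expresses_unique:
  assumes "expresses k l ns lam \<kappa> m c p" "expresses k l ns lam \<kappa> m' c' p"
  shows "c * denom l m' = c' * denom l m"
proof -
  have *: "c \<in> labelled labels" "lsubst mconst form c = p * dprod m" if "expresses k l ns lam \<kappa> m c p" for c m
  proof -
    have c: "c \<in> labelled (gens k l ns)"
      using that by (simp add: expresses_def labelled_def)
    then show "c \<in> labelled labels"
      using labelled_mono[of "gens k l ns" labels] by (auto simp: labels_def)
    have "lsubst mconst form c = lsubst mconst (gen_form ns) c"
      by (rule lsubst_labelled_cong[OF c]) (simp_all add: form_gen)
    also have "\<dots> = p * dprod m"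
      using that by (simp add: expresses_def mext_def dprod_def)
    finally show "lsubst mconst form c = p * dprod m" .
  qed
  have "lsubst mconst form (c * denom l m' - c' * denom l m) = 0"
    unfolding form.ext.hom_minus form.ext.hom_mult lsubst_denom *(2)[OF assms(1)] *(2)[OF assms(2)]
    by (simp add: mult_ac)
  moreover have "c * denom l m' - c' * denom l m \<in> labelled labels"
    by (intro subring_setD(5,6)[OF subring_set_labelled] *(1) denom_labelled assms)
      (rule assms)+
  ultimately have "c * denom l m' - c' * denom l m = 0"
    by (rule labels_independent[rotated])
  then show ?thesis by simp
qed

end

theorem theorem1p2:
  fixes lam :: "nat \<Rightarrow> 'a::field_char_0" and ns :: "nat \<Rightarrow> nat" and k l :: nat
  assumes "0 < l" and "l \<le> k"
    and "\<And>i j. 1 \<le> i \<Longrightarrow> i \<le> j \<Longrightarrow> j \<le> l \<Longrightarrow> ns j \<le> ns i"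
    and "\<And>i. 1 \<le> i \<Longrightarrow> i \<le> l \<Longrightarrow> 2 \<le> ns i"
    and "\<And>i. l < i \<Longrightarrow> i \<le> k \<Longrightarrow> ns i = 1"
    and "\<And>i. 1 \<le> i \<Longrightarrow> i \<le> k \<Longrightarrow> lam i \<noteq> 0"
  shows "card (gens k l ns) = (\<Sum>i = 1..k. ns i) - 1
    \<and> (\<forall>x \<in> gens k l ns. homogeneous (gen_form ns x :: 'a mpoly) \<and>
          semi_invariant (jordan_diag k ns lam) (gen_mult lam x) (gen_form ns x))
    \<and> (\<forall>\<kappa> p. semi_invariant (jordan_diag k ns lam) \<kappa> p \<longrightarrow>
          (\<exists>m c. expresses k l ns lam \<kappa> m c p) \<and>
          (\<forall>m c m' c'. expresses k l ns lam \<kappa> m c p \<longrightarrow> expresses k l ns lam \<kappa> m' c' p \<longrightarrow>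
             c * denom l m' = c' * denom l m))"
proof -
  interpret jordan_data lam ns k l
    by unfold_locales (use assms in auto)
  show ?thesis
    by (intro conjI ballI allI impI card_gens homogeneous_gen_form semi_invariant_gen_form
        expresses_exists expresses_unique)
qed

end
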